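(* Let $\mathcal{B}$ be a Serre subcategory of an abelian category $\mathcal{A}$, and let $\mathcal{E}\subset\mathcal{A}$ be the full subcategory of $\mathcal{B}$-closed objects. Assume that $\mathcal{A}$ admits a torsion pair $({}^{\perp}\mathcal{E},\mathcal{F})$. Then $\mathcal{B}\subset\mathcal{A}$ is weakly localising if and only if $\mathcal{F}$ satisfies the embedding condition with respect to $\mathcal{E}$.
   Context: The full subcategory of $\mathcal{B}$-closed objects is $\mathcal{E}=\{A\in\mathcal{A}\mid\operatorname{Hom}(B,A)=0=\operatorname{Ext}^1(B,A)\ \text{for all } B\in\mathcal{B}\}$. The quotient functor $q\colon\mathcal{A}\to\mathcal{A}/\mathcal{B}=:\mathcal{C}$ is fully faithful on $\mathcal{E}$, so $\mathcal{E}$ is regarded as a full subcategory of $\mathcal{C}$ (via its essential image). A torsion pair $(\mathcal{T},\mathcal{F})$ in an abelian category is a pair of full subcategories with $\operatorname{Hom}(\mathcal{T},\mathcal{F})=0$ such that every object $A$ fits into a short exact sequence $0\to T\to A\to F\to0$ with $T\in\mathcal{T}$, $F\in\mathcal{F}$; $\mathcal{T}$ is the torsion part and $\mathcal{F}$ the torsion-free part. ${}^{\perp}\mathcal{E}=\{A\in\mathcal{A}\mid\operatorname{Hom}(A,E)=0\ \text{for all }E\in\mathcal{E}\}$. $\mathcal{B}\subset\mathcal{A}$ is weakly localising if $\mathcal{E}$ is the torsion-free part of a torsion pair $(\overline{\mathcal{T}},\mathcal{E})$ in $\mathcal{C}$. For a full subcategory $\mathcal{G}\subset\mathcal{E}$,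 a full subcategory $\mathcal{F}\subset\mathcal{A}$ satisfies the embedding condition with respect to $\mathcal{G}$ if for every $F\in\mathcal{F}$ there exist $G\in\mathcal{G}$, $B\in\mathcal{B}$ and a short exact sequence $0\to F\to G\to B\to 0$ in $\mathcal{A}$. *)

theory Defs
  imports "HOL-Algebra.Group"
begin

section \<open>Preadditive and abelian categories\<close>

text \<open>
  Hom-sets are families of subsets of one type of arrows, and composition is untyped; the axioms
  below make hom-sets pairwise disjoint, so an arrow determines its source and target.
  A full subcategory is represented by its set of objects.
\<close>

record ('o, 'm) precat =
  Ob :: "'o set"
  Hom :: "'o \<Rightarrow> 'o \<Rightarrow> 'm set"
  Idn :: "'o \<Rightarrow> 'm"
  Comp :: "'m \<Rightarrow> 'm \<Rightarrow> 'm"  (infixl "\<cdot>\<index>" 70)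
  Add :: "'m \<Rightarrow> 'm \<Rightarrow> 'm"
  Zero :: "'o \<Rightarrow> 'o \<Rightarrow> 'm"

locale category =
  fixes C :: "('o, 'm) precat" (structure)
  assumes Hom_Ob: "f \<in> Hom C x y \<Longrightarrow> x \<in> Ob C \<and> y \<in> Ob C"
    and Hom_disjoint: "f \<in> Hom C x y \<Longrightarrow> f \<in> Hom C x' y' \<Longrightarrow> x = x' \<and> y = y'"
    and Idn_Hom: "x \<in> Ob C \<Longrightarrow> Idn C x \<in> Hom C x x"
    and Comp_Hom: "f \<in> Hom C x y \<Longrightarrow> g \<in> Hom C y z \<Longrightarrow> g \<cdot> f \<in> Hom C x z"
    and Comp_Idn_left: "f \<in> Hom C x y \<Longrightarrow> Idn C y \<cdot> f = f"
    and Comp_Idn_right: "f \<in> Hom C x y \<Longrightarrow> f \<cdot> Idn C x = f"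
    and Comp_assoc: "f \<in> Hom C w x \<Longrightarrow> g \<in> Hom C x y \<Longrightarrow> h \<in> Hom C y z
      \<Longrightarrow> (h \<cdot> g) \<cdot> f = h \<cdot> (g \<cdot> f)"

locale preadditive_category = category +
  assumes Hom_comm_group: "x \<in> Ob C \<Longrightarrow> y \<in> Ob C
      \<Longrightarrow> comm_group \<lparr>carrier = Hom C x y, mult = Add C, one = Zero C x y\<rparr>"
    and Comp_Add_left: "f \<in> Hom C x y \<Longrightarrow> f' \<in> Hom C x y \<Longrightarrow> g \<in> Hom C y z
      \<Longrightarrow> g \<cdot> Add C f f' = Add C (g \<cdot> f) (g \<cdot> f')"
    and Comp_Add_right: "f \<in> Hom C x y \<Longrightarrow> g \<in> Hom C y z \<Longrightarrow> g' \<in> Hom C y z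
      \<Longrightarrow> Add C g g' \<cdot> f = Add C (g \<cdot> f) (g' \<cdot> f)"

definition zero_object :: "('o, 'm) precat \<Rightarrow> 'o \<Rightarrow> bool" where
  "zero_object C z \<longleftrightarrow> z \<in> Ob C \<and>
    (\<forall>x\<in>Ob C. (\<exists>!f. f \<in> Hom C x z) \<and> (\<exists>!f. f \<in> Hom C z x))"

definition monic :: "('o, 'm) precat \<Rightarrow> 'o \<Rightarrow> 'o \<Rightarrow> 'm \<Rightarrow> bool" where
  "monic C x y f \<longleftrightarrow> f \<in> Hom C x y \<and>
    (\<forall>w. \<forall>g\<in>Hom C w x. \<forall>h\<in>Hom C w x. f \<cdot>\<^bsub>C\<^esub> g = f \<cdot>\<^bsub>C\<^esub> h \<longrightarrow> g = h)"

definition epic :: "('o, 'm) precat \<Rightarrow> 'o \<Rightarrow> 'o \<Rightarrow> 'm \<Rightarrow> bool" where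
  "epic C x y f \<longleftrightarrow> f \<in> Hom C x y \<and>
    (\<forall>z. \<forall>g\<in>Hom C y z. \<forall>h\<in>Hom C y z. g \<cdot>\<^bsub>C\<^esub> f = h \<cdot>\<^bsub>C\<^esub> f \<longrightarrow> g = h)"

definition iso_arrow :: "('o, 'm) precat \<Rightarrow> 'o \<Rightarrow> 'o \<Rightarrow> 'm \<Rightarrow> bool" where
  "iso_arrow C x y f \<longleftrightarrow> f \<in> Hom C x y \<and>
    (\<exists>g\<in>Hom C y x. g \<cdot>\<^bsub>C\<^esub> f = Idn C x \<and> f \<cdot>\<^bsub>C\<^esub> g = Idn C y)"

definition isomorphic :: "('o, 'm) precat \<Rightarrow> 'o \<Rightarrow> 'o \<Rightarrow> bool" where
  "isomorphic C x y \<longleftrightarrow> (\<exists>f. iso_arrow C x y f)"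

text \<open>\<open>is_kernel C x y f k i\<close>: the arrow \<open>i : k \<rightarrow> x\<close> is a kernel of \<open>f : x \<rightarrow> y\<close>; dually below.\<close>

definition is_kernel :: "('o, 'm) precat \<Rightarrow> 'o \<Rightarrow> 'o \<Rightarrow> 'm \<Rightarrow> 'o \<Rightarrow> 'm \<Rightarrow> bool" where
  "is_kernel C x y f k i \<longleftrightarrow>
    f \<in> Hom C x y \<and> i \<in> Hom C k x \<and> f \<cdot>\<^bsub>C\<^esub> i = Zero C k y \<and>
    (\<forall>w. \<forall>g\<in>Hom C w x. f \<cdot>\<^bsub>C\<^esub> g = Zero C w y \<longrightarrow> (\<exists>!h. h \<in> Hom C w k \<and> i \<cdot>\<^bsub>C\<^esub> h = g))"

definition is_cokernel :: "('o, 'm) precat \<Rightarrow> 'o \<Rightarrow> 'o \<Rightarrow> 'm \<Rightarrow> 'o \<Rightarrow> 'm \<Rightarrow> bool" where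
  "is_cokernel C x y f c p \<longleftrightarrow>
    f \<in> Hom C x y \<and> p \<in> Hom C y c \<and> p \<cdot>\<^bsub>C\<^esub> f = Zero C x c \<and>
    (\<forall>z. \<forall>g\<in>Hom C y z. g \<cdot>\<^bsub>C\<^esub> f = Zero C x z \<longrightarrow> (\<exists>!h. h \<in> Hom C c z \<and> h \<cdot>\<^bsub>C\<^esub> p = g))"

definition is_biproduct ::
  "('o, 'm) precat \<Rightarrow> 'o \<Rightarrow> 'o \<Rightarrow> 'o \<Rightarrow> 'm \<Rightarrow> 'm \<Rightarrow> 'm \<Rightarrow> 'm \<Rightarrow> bool" where
  "is_biproduct C x y s i1 i2 p1 p2 \<longleftrightarrow>
    i1 \<in> Hom C x s \<and> i2 \<in> Hom C y s \<and> p1 \<in> Hom C s x \<and> p2 \<in> Hom C s y \<and>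
    p1 \<cdot>\<^bsub>C\<^esub> i1 = Idn C x \<and> p2 \<cdot>\<^bsub>C\<^esub> i2 = Idn C y \<and>
    p2 \<cdot>\<^bsub>C\<^esub> i1 = Zero C x y \<and> p1 \<cdot>\<^bsub>C\<^esub> i2 = Zero C y x \<and>
    Add C (i1 \<cdot>\<^bsub>C\<^esub> p1) (i2 \<cdot>\<^bsub>C\<^esub> p2) = Idn C s"

locale abelian_category = preadditive_category +
  assumes ex_zero_object: "\<exists>z. zero_object C z"
    and ex_biproduct: "x \<in> Ob C \<Longrightarrow> y \<in> Ob C \<Longrightarrow> \<exists>s i1 i2 p1 p2. is_biproduct C x y s i1 i2 p1 p2"
    and ex_kernel: "f \<in> Hom C x y \<Longrightarrow> \<exists>k i. is_kernel C x y f k i"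
    and ex_cokernel: "f \<in> Hom C x y \<Longrightarrow> \<exists>c p. is_cokernel C x y f c p"
    and monic_normal: "monic C k x i \<Longrightarrow> \<exists>y f. is_kernel C x y f k i"
    and epic_normal: "epic C y c p \<Longrightarrow> \<exists>x f. is_cokernel C x y f c p"

text \<open>\<open>short_exact C x y z f g\<close>: the sequence \<open>0 \<rightarrow> x \<rightarrow> y \<rightarrow> z \<rightarrow> 0\<close> with arrows \<open>f\<close>, \<open>g\<close> is exact.\<close>

definition short_exact :: "('o, 'm) precat \<Rightarrow> 'o \<Rightarrow> 'o \<Rightarrow> 'o \<Rightarrow> 'm \<Rightarrow> 'm \<Rightarrow> bool" where
  "short_exact C x y z f g \<longleftrightarrow> is_kernel C y z g x f \<and> is_cokernel C x y f z g"

section \<open>Yoneda Ext, closed objects and torsion pairs\<close>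

text \<open>
  \<open>Ext1 C z x\<close> is the set of classes of extensions \<open>0 \<rightarrow> x \<rightarrow> y \<rightarrow> z \<rightarrow> 0\<close>;
  its zero element is the class of the split extensions.
\<close>

definition extensions :: "('o, 'm) precat \<Rightarrow> 'o \<Rightarrow> 'o \<Rightarrow> ('o \<times> 'm \<times> 'm) set" where
  "extensions C z x = {(y, i, p). short_exact C x y z i p}"

definition ext_rel ::
  "('o, 'm) precat \<Rightarrow> 'o \<Rightarrow> 'o \<Rightarrow> (('o \<times> 'm \<times> 'm) \<times> ('o \<times> 'm \<times> 'm)) set" where
  "ext_rel C z x = {((y, i, p), (y', i', p')).
     (y, i, p) \<in> extensions C z x \<and> (y', i', p') \<in> extensions C z x \<and>
     (\<exists>\<phi>. iso_arrow C y y' \<phi> \<and> \<phi> \<cdot>\<^bsub>C\<^esub> i = i' \<and> p' \<cdot>\<^bsub>C\<^esub> \<phi> = p)}"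

definition Ext1 :: "('o, 'm) precat \<Rightarrow> 'o \<Rightarrow> 'o \<Rightarrow> ('o \<times> 'm \<times> 'm) set set" where
  "Ext1 C z x = extensions C z x // ext_rel C z x"

definition Ext1_zero :: "('o, 'm) precat \<Rightarrow> 'o \<Rightarrow> 'o \<Rightarrow> ('o \<times> 'm \<times> 'm) set" where
  "Ext1_zero C z x = {(y, i, p). \<exists>j r. is_biproduct C x z y i j r p}"

definition closed_objects :: "('o, 'm) precat \<Rightarrow> 'o set \<Rightarrow> 'o set" where
  "closed_objects A \<B> = {a \<in> Ob A. \<forall>b\<in>\<B>. Hom A b a = {Zero A b a} \<and> Ext1 A b a = {Ext1_zero A b a}}"

definition left_perp :: "('o, 'm) precat \<Rightarrow> 'o set \<Rightarrow> 'o set" where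
  "left_perp A \<E> = {a \<in> Ob A. \<forall>e\<in>\<E>. Hom A a e = {Zero A a e}}"

definition torsion_pair :: "('o, 'm) precat \<Rightarrow> 'o set \<Rightarrow> 'o set \<Rightarrow> bool" where
  "torsion_pair C \<T> \<F> \<longleftrightarrow> \<T> \<subseteq> Ob C \<and> \<F> \<subseteq> Ob C \<and>
    (\<forall>t\<in>\<T>. \<forall>f\<in>\<F>. Hom C t f = {Zero C t f}) \<and>
    (\<forall>a\<in>Ob C. \<exists>t\<in>\<T>. \<exists>f\<in>\<F>. \<exists>i p. short_exact C t a f i p)"

section \<open>Serre subcategories and quotient categories\<close>

definition serre_subcategory :: "('o, 'm) precat \<Rightarrow> 'o set \<Rightarrow> bool" where
  "serre_subcategory A \<B> \<longleftrightarrow> \<B> \<subseteq> Ob A \<and> \<B> \<noteq> {} \<and>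
    (\<forall>x y z f g. short_exact A x y z f g \<longrightarrow> (y \<in> \<B> \<longleftrightarrow> x \<in> \<B> \<and> z \<in> \<B>))"

text \<open>
  The quotient of \<open>A\<close> by a Serre subcategory \<open>\<B>\<close> is the localisation of \<open>A\<close> at the arrows whose
  kernel and cokernel lie in \<open>\<B>\<close>. These admit a calculus of fractions, so the arrows \<open>x \<rightarrow> y\<close> of the
  quotient are classes of roofs \<open>x \<leftarrow> w \<rightarrow> y\<close>, the first leg \<open>s\<close> being inverted; \<open>(s, f)\<close> stands for
  \<open>f \<circ> s\<inverse>\<close>.
\<close>

definition inverted_arrow :: "('o, 'm) precat \<Rightarrow> 'o set \<Rightarrow> 'o \<Rightarrow> 'o \<Rightarrow> 'm \<Rightarrow> bool" where
  "inverted_arrow A \<B> x y s \<longleftrightarrow> s \<in> Hom A x y \<and>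
    (\<exists>k\<in>\<B>. \<exists>i. is_kernel A x y s k i) \<and> (\<exists>c\<in>\<B>. \<exists>p. is_cokernel A x y s c p)"

definition roofs :: "('o, 'm) precat \<Rightarrow> 'o set \<Rightarrow> 'o \<Rightarrow> 'o \<Rightarrow> ('m \<times> 'm) set" where
  "roofs A \<B> x y = {(s, f). \<exists>w. inverted_arrow A \<B> w x s \<and> f \<in> Hom A w y}"

definition roof_rel :: "('o, 'm) precat \<Rightarrow> 'o set \<Rightarrow> 'o \<Rightarrow> 'o \<Rightarrow> (('m \<times> 'm) \<times> ('m \<times> 'm)) set" where
  "roof_rel A \<B> x y = {((s, f), (s', f')). \<exists>w w' v u u'.
     inverted_arrow A \<B> w x s \<and> f \<in> Hom A w y \<and>
     inverted_arrow A \<B> w' x s' \<and> f' \<in> Hom A w' y \<and>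
     u \<in> Hom A v w \<and> u' \<in> Hom A v w' \<and>
     s \<cdot>\<^bsub>A\<^esub> u = s' \<cdot>\<^bsub>A\<^esub> u' \<and> inverted_arrow A \<B> v x (s \<cdot>\<^bsub>A\<^esub> u) \<and> f \<cdot>\<^bsub>A\<^esub> u = f' \<cdot>\<^bsub>A\<^esub> u'}"

definition roof_class :: "('o, 'm) precat \<Rightarrow> 'o set \<Rightarrow> 'o \<Rightarrow> 'o \<Rightarrow> 'm \<times> 'm \<Rightarrow> ('m \<times> 'm) set" where
  "roof_class A \<B> x y r = roof_rel A \<B> x y `` {r}"

text \<open>The quotient functor on arrows; on objects it is the identity.\<close>

definition quot_arrow :: "('o, 'm) precat \<Rightarrow> 'o set \<Rightarrow> 'o \<Rightarrow> 'o \<Rightarrow> 'm \<Rightarrow> ('m \<times> 'm) set" where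
  "quot_arrow A \<B> x y f = roof_class A \<B> x y (Idn A x, f)"

definition quot_obj :: "('o, 'm) precat \<Rightarrow> 'o set \<Rightarrow> 'o \<Rightarrow> 'o" where
  "quot_obj A \<B> x = x"

text \<open>
  To compose \<open>(s, f) : x \<leftarrow> w \<rightarrow> y\<close> with \<open>(t, g) : y \<leftarrow> w' \<rightarrow> z\<close>, complete \<open>f\<close> and \<open>t\<close> to a
  commutative square \<open>f \<circ> t' = t \<circ> f'\<close> with \<open>t'\<close> inverted. The result does not depend on the
  choices, so the union over all choices is a single class. Addition uses a common denominator.
\<close>

definition quot_comp ::
  "('o, 'm) precat \<Rightarrow> 'o set \<Rightarrow> ('m \<times> 'm) set \<Rightarrow> ('m \<times> 'm) set \<Rightarrow> ('m \<times> 'm) set" where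
  "quot_comp A \<B> d c = \<Union> {roof_class A \<B> x z (s \<cdot>\<^bsub>A\<^esub> t', g \<cdot>\<^bsub>A\<^esub> f') | x y z w w' v s f t g t' f'.
     (s, f) \<in> c \<and> (t, g) \<in> d \<and>
     inverted_arrow A \<B> w x s \<and> f \<in> Hom A w y \<and>
     inverted_arrow A \<B> w' y t \<and> g \<in> Hom A w' z \<and>
     inverted_arrow A \<B> v w t' \<and> f' \<in> Hom A v w' \<and> f \<cdot>\<^bsub>A\<^esub> t' = t \<cdot>\<^bsub>A\<^esub> f'}"

definition quot_add ::
  "('o, 'm) precat \<Rightarrow> 'o set \<Rightarrow> ('m \<times> 'm) set \<Rightarrow> ('m \<times> 'm) set \<Rightarrow> ('m \<times> 'm) set" where
  "quot_add A \<B> c d = \<Union> {roof_class A \<B> x y (s, Add A f g) | x y w s f g.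
     (s, f) \<in> c \<and> (s, g) \<in> d \<and>
     inverted_arrow A \<B> w x s \<and> f \<in> Hom A w y \<and> g \<in> Hom A w y}"

definition quotient_category :: "('o, 'm) precat \<Rightarrow> 'o set \<Rightarrow> ('o, ('m \<times> 'm) set) precat" where
  "quotient_category A \<B> =
    \<lparr>Ob = Ob A,
     Hom = (\<lambda>x y. roofs A \<B> x y // roof_rel A \<B> x y),
     Idn = (\<lambda>x. quot_arrow A \<B> x x (Idn A x)),
     Comp = quot_comp A \<B>,
     Add = quot_add A \<B>,
     Zero = (\<lambda>x y. quot_arrow A \<B> x y (Zero A x y))\<rparr>"

section \<open>Weakly localising subcategories and the embedding condition\<close>

definition quot_essential_image :: "('o, 'm) precat \<Rightarrow> 'o set \<Rightarrow> 'o set \<Rightarrow> 'o set" where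
  "quot_essential_image A \<B> \<E> = {x \<in> Ob (quotient_category A \<B>).
     \<exists>e\<in>\<E>. isomorphic (quotient_category A \<B>) (quot_obj A \<B> e) x}"

definition weakly_localising :: "('o, 'm) precat \<Rightarrow> 'o set \<Rightarrow> bool" where
  "weakly_localising A \<B> \<longleftrightarrow>
    (\<exists>\<T>. torsion_pair (quotient_category A \<B>) \<T>
       (quot_essential_image A \<B> (closed_objects A \<B>)))"

definition embedding_condition :: "('o, 'm) precat \<Rightarrow> 'o set \<Rightarrow> 'o set \<Rightarrow> 'o set \<Rightarrow> bool" where
  "embedding_condition A \<B> \<G> \<F> \<longleftrightarrow>
    (\<forall>f\<in>\<F>. \<exists>g\<in>\<G>. \<exists>b\<in>\<B>. \<exists>i p. short_exact A f g b i p)"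

end

theory Submission
  imports Defs
begin

text \<open>
  In one direction, an object \<open>F\<close> of \<open>\<F>\<close> maps in the quotient onto its torsion-free part,
  represented by a closed object \<open>E\<close>. The quotient functor is fully faithful on arrows into closed
  objects, so this map lifts to \<open>m : F \<rightarrow> E\<close>. The kernel of \<open>m\<close> becomes the torsion part of \<open>F\<close>,
  so it lies in the left perpendicular of the closed objects and, being a subobject of \<open>F\<close>, vanishes;
  the cokernel of \<open>m\<close> vanishes in the quotient, i.e. lies in \<open>\<B>\<close>. Conversely, the exact quotient
  functor carries the torsion pair of \<open>A\<close> to the required one: the embedding condition says that
  objects of \<open>\<F>\<close> become isomorphic to closed objects.
\<close>

section \<open>Preadditive and abelian categories\<close>

text \<open>The lift exists because an inverted arrow out of a closed object is a split monic: its
  kernel lies in \<B> and maps to the closed object only by zero, and its cokernel in \<B> then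
  makes it an extension, which the vanishing of Ext^1 splits. But the arrows of the quotient are
  roofs, whose inverted leg ends at the source, whereas this splitting needs an inverted arrow
  starting at the target. Hence each roof is first rewritten as a left fraction by the dual Ore
  condition; cokernels in the quotient need the same rewriting.

  A torsion pair speaks only of objects, arrows, zero arrows, kernels and cokernels. The quotient
  therefore has to supply a category in which zero arrows absorb composition and in which kernels
  and cokernels taken in \<open>A\<close> stay kernels and cokernels. Composition is a union over
  all choices of Ore squares, so most of the labour is to show that the choices agree.\<close>

context category
begin

lemma square_extend:
  assumes "f \<cdot> u = g \<cdot> v" "u \<in> Hom C a b" "f \<in> Hom C b d" "v \<in> Hom C a c" "g \<in> Hom C c d"
    "h \<in> Hom C e a"
  shows "f \<cdot> (u \<cdot> h) = g \<cdot> (v \<cdot> h)"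
  using Comp_assoc[OF assms(6,2,3)] Comp_assoc[OF assms(6,4,5)] assms(1) by simp

lemma monic_cancel:
  "monic C x y f \<Longrightarrow> g \<in> Hom C w x \<Longrightarrow> h \<in> Hom C w x \<Longrightarrow> f \<cdot> g = f \<cdot> h \<Longrightarrow> g = h"
  unfolding monic_def by blast

lemma epic_cancel:
  "epic C x y f \<Longrightarrow> g \<in> Hom C y z \<Longrightarrow> h \<in> Hom C y z \<Longrightarrow> g \<cdot> f = h \<cdot> f \<Longrightarrow> g = h"
  unfolding epic_def by blast

lemma monic_Comp:
  assumes "monic C x y f" "monic C y z g"
  shows "monic C x z (g \<cdot> f)"
  unfolding monic_def
proof (intro conjI allI ballI impI)
  have f: "f \<in> Hom C x y" and g: "g \<in> Hom C y z" using assms by (auto simp: monic_def)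
  then show "g \<cdot> f \<in> Hom C x z" by (rule Comp_Hom)
  fix w h k assume h: "h \<in> Hom C w x" and k: "k \<in> Hom C w x" and e: "g \<cdot> f \<cdot> h = g \<cdot> f \<cdot> k"
  have "f \<cdot> h = f \<cdot> k"
    using monic_cancel[OF assms(2) Comp_Hom[OF h f] Comp_Hom[OF k f]] e
      Comp_assoc[OF h f g] Comp_assoc[OF k f g] by simp
  then show "h = k" using monic_cancel[OF assms(1) h k] by simp
qed

end

text \<open>Instantiating a lemma in the opposite category and simplifying with the rules below
  gives its dual; epics, cokernels and the left Ore condition are obtained in this way.\<close>

definition op_cat :: "('o, 'm) precat \<Rightarrow> ('o, 'm) precat" where
  "op_cat C = \<lparr>Ob = Ob C, Hom = (\<lambda>x y. Hom C y x), Idn = Idn C,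
     Comp = (\<lambda>g f. f \<cdot>\<^bsub>C\<^esub> g), Add = Add C, Zero = (\<lambda>x y. Zero C y x)\<rparr>"

lemma op_cat_simps [simp]:
  "Ob (op_cat C) = Ob C" "Hom (op_cat C) x y = Hom C y x" "Idn (op_cat C) = Idn C"
  "g \<cdot>\<^bsub>op_cat C\<^esub> f = f \<cdot>\<^bsub>C\<^esub> g" "Add (op_cat C) = Add C" "Zero (op_cat C) x y = Zero C y x"
  by (simp_all add: op_cat_def)

lemma op_cat_dual [simp]:
  "monic (op_cat C) x y f = epic C y x f"
  "epic (op_cat C) x y f = monic C y x f"
  "is_kernel (op_cat C) x y f = is_cokernel C y x f"
  "is_cokernel (op_cat C) x y f = is_kernel C y x f"
  "short_exact (op_cat C) x y z f g = short_exact C z y x g f"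
  "zero_object (op_cat C) = zero_object C"
  unfolding monic_def epic_def is_kernel_def is_cokernel_def short_exact_def zero_object_def
  by (auto simp: fun_eq_iff)

section \<open>Zero arrows, differences and kernels in a preadditive category\<close>

context preadditive_category
begin

lemma Zero_Hom: "x \<in> Ob C \<Longrightarrow> y \<in> Ob C \<Longrightarrow> Zero C x y \<in> Hom C x y"
  using comm_group.axioms(2)[OF Hom_comm_group] group.is_monoid monoid.one_closed by fastforce

lemma Add_Hom: "f \<in> Hom C x y \<Longrightarrow> g \<in> Hom C x y \<Longrightarrow> Add C f g \<in> Hom C x y"
  using monoid.m_closed[OF group.is_monoid[OF comm_group.axioms(2)[OF Hom_comm_group]]] Hom_Ob
  by fastforce

lemma Add_Zero: "f \<in> Hom C x y \<Longrightarrow> Add C f (Zero C x y) = f"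
  using monoid.r_one[OF group.is_monoid[OF comm_group.axioms(2)[OF Hom_comm_group]]] Hom_Ob
  by fastforce

lemma Zero_Add: "f \<in> Hom C x y \<Longrightarrow> Add C (Zero C x y) f = f"
  using monoid.l_one[OF group.is_monoid[OF comm_group.axioms(2)[OF Hom_comm_group]]] Hom_Ob
  by fastforce

lemma Add_right_cancel:
  "f \<in> Hom C x y \<Longrightarrow> g \<in> Hom C x y \<Longrightarrow> h \<in> Hom C x y \<Longrightarrow> Add C g f = Add C h f \<longleftrightarrow> g = h"
  using group.right_cancel[OF comm_group.axioms(2)[OF Hom_comm_group]] Hom_Ob
  by fastforce

lemma Comp_Zero:
  assumes "f \<in> Hom C x y" "w \<in> Ob C"
  shows "f \<cdot> Zero C w x = Zero C w y"
proof -
  have O: "x \<in> Ob C" "y \<in> Ob C" using assms Hom_Ob by auto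
  have z: "Zero C w x \<in> Hom C w x" using Zero_Hom assms O by auto
  have c: "f \<cdot> Zero C w x \<in> Hom C w y" using Comp_Hom z assms by auto
  have "Add C (f \<cdot> Zero C w x) (f \<cdot> Zero C w x) = Add C (Zero C w y) (f \<cdot> Zero C w x)"
    using Comp_Add_left[OF z z assms(1)] Add_Zero[OF z] Zero_Add[OF c] by simp
  then show ?thesis using Add_right_cancel[OF c c Zero_Hom[OF assms(2) O(2)]] by simp
qed

lemma Zero_Comp:
  assumes "f \<in> Hom C x y" "z \<in> Ob C"
  shows "Zero C y z \<cdot> f = Zero C x z"
proof -
  have O: "x \<in> Ob C" "y \<in> Ob C" using assms Hom_Ob by auto
  have z: "Zero C y z \<in> Hom C y z" using Zero_Hom assms O by auto
  have c: "Zero C y z \<cdot> f \<in> Hom C x z" using Comp_Hom z assms by auto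
  have "Add C (Zero C y z \<cdot> f) (Zero C y z \<cdot> f) = Add C (Zero C x z) (Zero C y z \<cdot> f)"
    using Comp_Add_right[OF assms(1) z z] Add_Zero[OF z] Zero_Add[OF c] by simp
  then show ?thesis using Add_right_cancel[OF c c Zero_Hom[OF O(1) assms(2)]] by simp
qed

text \<open>The witness is \<open>f - g\<close>. Its characterisation between two arrows
  \<open>l\<close> and \<open>h\<close> is the form in which subtraction is applied, so later proofs
  never touch inverses in the hom-groups.\<close>

lemma ex_difference:
  assumes f: "f \<in> Hom C x y" and g: "g \<in> Hom C x y"
  shows "\<exists>d\<in>Hom C x y. \<forall>w l z h. l \<in> Hom C w x \<longrightarrow> h \<in> Hom C y z \<longrightarrow>
    h \<cdot> (d \<cdot> l) = Zero C w z \<longleftrightarrow> h \<cdot> (f \<cdot> l) = h \<cdot> (g \<cdot> l)"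
proof -
  interpret H: comm_group "\<lparr>carrier = Hom C x y, mult = Add C, one = Zero C x y\<rparr>"
    using Hom_comm_group Hom_Ob f by blast
  let ?G = "\<lparr>carrier = Hom C x y, mult = Add C, one = Zero C x y\<rparr>"
  define d where "d = Add C f (inv\<^bsub>?G\<^esub> g)"
  have i: "inv\<^bsub>?G\<^esub> g \<in> Hom C x y" using H.inv_closed[of g] g by simp
  have d: "d \<in> Hom C x y" unfolding d_def by (rule Add_Hom[OF f i])
  have dg: "Add C d g = f" unfolding d_def
    using H.m_assoc[of f "inv\<^bsub>?G\<^esub> g" g] H.l_inv[of g] f g i Add_Zero[OF f] by simp
  have "h \<cdot> (d \<cdot> l) = Zero C w z \<longleftrightarrow> h \<cdot> (f \<cdot> l) = h \<cdot> (g \<cdot> l)"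
    if l: "l \<in> Hom C w x" and h: "h \<in> Hom C y z" for w l z h
  proof -
    have t: "d \<cdot> l \<in> Hom C w y" "g \<cdot> l \<in> Hom C w y"
      "h \<cdot> (d \<cdot> l) \<in> Hom C w z" "h \<cdot> (g \<cdot> l) \<in> Hom C w z"
      using Comp_Hom l h d g by blast+
    have "h \<cdot> (f \<cdot> l) = Add C (h \<cdot> (d \<cdot> l)) (h \<cdot> (g \<cdot> l))"
      using Comp_Add_right[OF l d g] Comp_Add_left[OF t(1,2) h] dg by simp
    then show ?thesis
      using Add_right_cancel[OF t(4) t(3) Zero_Hom] Zero_Add[OF t(4)] Hom_Ob l h by metis
  qed
  then show ?thesis using d by blast
qed

lemma monicI:
  assumes f: "f \<in> Hom C x y"
    and *: "\<And>w g. g \<in> Hom C w x \<Longrightarrow> f \<cdot> g = Zero C w y \<Longrightarrow> g = Zero C w x"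
  shows "monic C x y f"
  unfolding monic_def
proof (intro conjI allI ballI impI f)
  fix w g h assume g: "g \<in> Hom C w x" and h: "h \<in> Hom C w x" and e: "f \<cdot> g = f \<cdot> h"
  obtain d where d: "d \<in> Hom C w x" and D: "\<And>v l z k. l \<in> Hom C v w \<Longrightarrow> k \<in> Hom C x z \<Longrightarrow>
    k \<cdot> (d \<cdot> l) = Zero C v z \<longleftrightarrow> k \<cdot> (g \<cdot> l) = k \<cdot> (h \<cdot> l)"
    using ex_difference[OF g h] by meson
  have O: "w \<in> Ob C" "x \<in> Ob C" using g Hom_Ob by auto
  have "f \<cdot> d = Zero C w y" using D[OF Idn_Hom f] e O by (metis Comp_Idn_right d g h)
  then have "d = Zero C w x" using * d by blast
  then show "g = h" using D[OF Idn_Hom Idn_Hom] O d g h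
    by (metis Comp_Idn_right Comp_Idn_left)
qed

lemma monic_Zero:
  assumes "monic C x y f" "g \<in> Hom C w x" "f \<cdot> g = Zero C w y"
  shows "g = Zero C w x"
  using assms monic_cancel[OF assms(1,2) Zero_Hom] Comp_Zero Hom_Ob
  unfolding monic_def by metis

lemma kernel_monic: "is_kernel C x y f k i \<Longrightarrow> monic C k x i"
  unfolding monic_def
proof (intro conjI allI ballI impI)
  assume K: "is_kernel C x y f k i"
  then show i: "i \<in> Hom C k x" by (simp add: is_kernel_def)
  fix w g h assume gh: "g \<in> Hom C w k" "h \<in> Hom C w k" "i \<cdot> g = i \<cdot> h"
  have "f \<cdot> (i \<cdot> g) = Zero C w y"
    using K gh Comp_assoc Zero_Comp Hom_Ob unfolding is_kernel_def by metis
  moreover have "i \<cdot> g \<in> Hom C w x" using Comp_Hom i gh by blast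
  ultimately show "g = h" using K gh unfolding is_kernel_def by metis
qed

lemma kernel_factor:
  assumes "is_kernel C x y f k i" "g \<in> Hom C w x" "f \<cdot> g = Zero C w y"
  shows "\<exists>h\<in>Hom C w k. i \<cdot> h = g"
proof -
  have "\<exists>!h. h \<in> Hom C w k \<and> i \<cdot> h = g" using assms unfolding is_kernel_def by simp
  then show ?thesis by blast
qed

lemma is_kernelI:
  assumes "f \<in> Hom C x y" "f \<cdot> i = Zero C k y" "monic C k x i"
    "\<And>w g. g \<in> Hom C w x \<Longrightarrow> f \<cdot> g = Zero C w y \<Longrightarrow> \<exists>h\<in>Hom C w k. i \<cdot> h = g"
  shows "is_kernel C x y f k i"
  unfolding is_kernel_def
proof (intro conjI allI ballI impI)
  show "f \<in> Hom C x y" "f \<cdot> i = Zero C k y" by fact+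
  show "i \<in> Hom C k x" using assms(3) by (simp add: monic_def)
  fix w g assume g: "g \<in> Hom C w x" "f \<cdot> g = Zero C w y"
  then obtain h where "h \<in> Hom C w k" "i \<cdot> h = g" using assms(4) by blast
  then show "\<exists>!h. h \<in> Hom C w k \<and> i \<cdot> h = g" using monic_cancel[OF assms(3)] by blast
qed

lemma is_kernelD:
  assumes "is_kernel C x y f k i"
  shows "f \<in> Hom C x y" "i \<in> Hom C k x" "f \<cdot> i = Zero C k y" "k \<in> Ob C" "x \<in> Ob C" "y \<in> Ob C"
  using assms Hom_Ob unfolding is_kernel_def by auto

lemma preadditive_op: "preadditive_category (op_cat C)"
proof -
  have "category (op_cat C)"
    unfolding category_def
    by (auto simp: Comp_assoc Comp_Idn_left Comp_Idn_right Hom_Ob Idn_Hom Comp_Hom dest: Hom_disjoint)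
  then show ?thesis
    unfolding preadditive_category_def preadditive_category_axioms_def
    using Hom_comm_group Comp_Add_left Comp_Add_right by simp
qed

lemmas epic_Comp =
  category.monic_Comp[OF preadditive_category.axioms(1)[OF preadditive_op], simplified]
lemmas epicI = preadditive_category.monicI[OF preadditive_op, simplified]
lemmas epic_Zero = preadditive_category.monic_Zero[OF preadditive_op, simplified]
lemmas cokernel_epic = preadditive_category.kernel_monic[OF preadditive_op, simplified]
lemmas cokernel_factor = preadditive_category.kernel_factor[OF preadditive_op, simplified]
lemmas is_cokernelD = preadditive_category.is_kernelD[OF preadditive_op, simplified]

end

section \<open>Image factorisation, normality and pullbacks of epics\<close>

context abelian_category
begin

lemma abelian_op: "abelian_category (op_cat C)"
proof -
  interpret op: preadditive_category "op_cat C" by (rule preadditive_op)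
  have "\<exists>s i1 i2 p1 p2. is_biproduct (op_cat C) x y s i1 i2 p1 p2"
    if xy: "x \<in> Ob C" "y \<in> Ob C" for x y
  proof -
    obtain s i1 i2 p1 p2 where "is_biproduct C x y s i1 i2 p1 p2"
      using ex_biproduct[OF xy] by blast
    then have "is_biproduct (op_cat C) x y s p1 p2 i1 i2" by (auto simp: is_biproduct_def)
    then show ?thesis by blast
  qed
  then show ?thesis
    by unfold_locales (auto intro: ex_zero_object ex_kernel ex_cokernel monic_normal epic_normal)
qed

text \<open>If \<open>n\<close> kills \<open>g\<close>, it factors through the cokernel
  \<open>q\<close> of \<open>g\<close>. The epic \<open>q \<cdot> e\<close> is the cokernel of some
  \<open>l\<close>; then \<open>f\<close> kills \<open>l\<close>, so \<open>l\<close> factors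
  through the kernel of \<open>f\<close> and \<open>e\<close> kills \<open>l\<close> as well. Hence
  \<open>e\<close> factors through \<open>q \<cdot> e\<close>, which makes \<open>q\<close> a split
  monic and forces \<open>g\<close> to vanish.\<close>

lemma coimage_monic:
  assumes K: "is_kernel C x y f k i" and E: "is_cokernel C k x i I e"
  shows "\<exists>n. monic C I y n \<and> n \<cdot> e = f"
proof -
  note k = is_kernelD[OF K] and e = is_cokernelD[OF E]
  obtain n where n: "n \<in> Hom C I y" "n \<cdot> e = f" using cokernel_factor[OF E k(1,3)] by blast
  have "monic C I y n"
  proof (rule monicI[OF n(1)])
    fix w g assume g: "g \<in> Hom C w I" "n \<cdot> g = Zero C w y"
    obtain Q q where Q: "is_cokernel C w I g Q q" using ex_cokernel[OF g(1)] by blast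
    note q = is_cokernelD[OF Q]
    obtain n' where n': "n' \<in> Hom C Q y" "n' \<cdot> q = n" using cokernel_factor[OF Q n(1) g(2)] by blast
    have "epic C x Q (q \<cdot> e)"
      by (rule epic_Comp[OF cokernel_epic[OF Q] cokernel_epic[OF E]])
    then obtain m l where L: "is_cokernel C m x l Q (q \<cdot> e)" using epic_normal by blast
    note l = is_cokernelD[OF L]
    have "f \<cdot> l = n' \<cdot> ((q \<cdot> e) \<cdot> l)"
      using Comp_assoc[OF l(1) e(2) n(1)] Comp_assoc[OF l(1) Comp_Hom[OF e(2) q(2)] n'(1)]
        Comp_assoc[OF e(2) q(2) n'(1)] n n' by simp
    then have "f \<cdot> l = Zero C m y" using l n' Comp_Zero by simp
    then obtain l' where l': "l' \<in> Hom C m k" "i \<cdot> l' = l" using kernel_factor[OF K l(1)] by blast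
    have "e \<cdot> l = Zero C m I"
      using l' e(3) Comp_assoc[OF l'(1) k(2) e(2)] Zero_Comp[OF l'(1) e(4)] by simp
    then obtain r where r: "r \<in> Hom C Q I" "r \<cdot> (q \<cdot> e) = e" using cokernel_factor[OF L e(2)] by blast
    have "r \<cdot> q = Idn C I"
      using epic_cancel[OF cokernel_epic[OF E], of "r \<cdot> q" I "Idn C I"] r Comp_assoc[OF e(2) q(2) r(1)]
        Comp_Hom[OF q(2) r(1)] Idn_Hom[OF e(4)] Comp_Idn_left[OF e(2)] by simp
    then have "g = r \<cdot> (q \<cdot> g)" using Comp_assoc[OF g(1) q(2) r(1)] Comp_Idn_left[OF g(1)] \<open>r \<cdot> q = Idn C I\<close> by simp
    then show "g = Zero C w I" using q(3) Comp_Zero[OF r(1) q(6)] by simp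
  qed
  then show ?thesis using n by blast
qed

text \<open>A monic is the kernel of some \<open>g\<close>; as \<open>g\<close> factors through the
  cokernel \<open>p\<close>, whatever \<open>p\<close> kills is killed by \<open>g\<close>
  too.\<close>

lemma monic_short_exact:
  assumes f: "monic C x y f" and P: "is_cokernel C x y f c p"
  shows "short_exact C x y c f p"
proof -
  note p = is_cokernelD[OF P]
  obtain z g where G: "is_kernel C y z g x f" using monic_normal[OF f] by blast
  note g = is_kernelD[OF G]
  obtain g' where g': "g' \<in> Hom C c z" "g' \<cdot> p = g" using cokernel_factor[OF P g(1,3)] by blast
  have "is_kernel C y c p x f"
  proof (rule is_kernelI[OF p(2,3) f])
    fix w h assume h: "h \<in> Hom C w y" "p \<cdot> h = Zero C w c"
    then have "g \<cdot> h = Zero C w z" using g' p Comp_assoc Comp_Zero Hom_Ob by metis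
    then show "\<exists>l\<in>Hom C w x. f \<cdot> l = h" using kernel_factor[OF G h(1)] by blast
  qed
  then show ?thesis using P by (simp add: short_exact_def)
qed

lemmas epic_short_exact =
  abelian_category.monic_short_exact[OF abelian_op, simplified]

text \<open>The pullback is the kernel \<open>k\<close> of the difference \<open>d\<close> of
  \<open>l \<cdot> p1\<close> and \<open>e \<cdot> p2\<close> on the biproduct. On the summand
  \<open>b\<close> this difference is \<open>-e\<close>, so \<open>d\<close> is epic and is the
  cokernel of \<open>k\<close>. The last conjunct, joint monicity of the two projections, stands in
  for the universal property.\<close>

lemma pullback_epic:
  assumes l: "l \<in> Hom C a c" and E: "epic C b c e"
  shows "\<exists>v t f. epic C v a t \<and> f \<in> Hom C v b \<and> l \<cdot> t = e \<cdot> f \<and>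
    (\<forall>w. \<forall>h\<in>Hom C w v. t \<cdot> h = Zero C w a \<longrightarrow> f \<cdot> h = Zero C w b \<longrightarrow> h = Zero C w v)"
proof -
  have e: "e \<in> Hom C b c" using E by (simp add: epic_def)
  have O: "a \<in> Ob C" "b \<in> Ob C" "c \<in> Ob C" using l e Hom_Ob by auto
  obtain s i1 i2 p1 p2 where B: "is_biproduct C a b s i1 i2 p1 p2" using ex_biproduct O by meson
  then have b: "i1 \<in> Hom C a s" "i2 \<in> Hom C b s" "p1 \<in> Hom C s a" "p2 \<in> Hom C s b"
    "p1 \<cdot> i1 = Idn C a" "p2 \<cdot> i2 = Idn C b" "p1 \<cdot> i2 = Zero C b a"
    "Add C (i1 \<cdot> p1) (i2 \<cdot> p2) = Idn C s"
    unfolding is_biproduct_def by auto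
  have s: "s \<in> Ob C" using b Hom_Ob by blast
  have t1: "l \<cdot> p1 \<in> Hom C s c" and t2: "e \<cdot> p2 \<in> Hom C s c" using b l e Comp_Hom by auto
  obtain d where d: "d \<in> Hom C s c" and D: "\<And>v j z k. j \<in> Hom C v s \<Longrightarrow> k \<in> Hom C c z \<Longrightarrow>
    k \<cdot> (d \<cdot> j) = Zero C v z \<longleftrightarrow> k \<cdot> ((l \<cdot> p1) \<cdot> j) = k \<cdot> ((e \<cdot> p2) \<cdot> j)"
    using ex_difference[OF t1 t2] by meson
  have di2: "h = Zero C c z" if h: "h \<in> Hom C c z" "h \<cdot> (d \<cdot> i2) = Zero C b z" for h z
  proof -
    have "h \<cdot> ((l \<cdot> p1) \<cdot> i2) = h \<cdot> ((e \<cdot> p2) \<cdot> i2)" using D[OF b(2) h(1)] h by simp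
    moreover have "(l \<cdot> p1) \<cdot> i2 = Zero C b c" using Comp_assoc[OF b(2,3) l] b(7) Comp_Zero l O by simp
    moreover have "(e \<cdot> p2) \<cdot> i2 = e" using Comp_assoc[OF b(2,4) e] b(6) Comp_Idn_right e by simp
    ultimately show ?thesis using epic_Zero[OF E h(1)] h Comp_Zero O by metis
  qed
  have dE: "epic C s c d"
  proof (rule epicI[OF d])
    fix z h assume h: "h \<in> Hom C c z" "h \<cdot> d = Zero C s z"
    then have "h \<cdot> (d \<cdot> i2) = Zero C b z" using Comp_assoc[OF b(2) d h(1)] Zero_Comp b(2) Hom_Ob by metis
    then show "h = Zero C c z" using di2 h by blast
  qed
  obtain v k where K: "is_kernel C s c d v k" using ex_kernel[OF d] by blast
  note k = is_kernelD[OF K]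
  have dK: "is_cokernel C v s k c d" using epic_short_exact[OF dE K] by (simp add: short_exact_def)
  have T: "p1 \<cdot> k \<in> Hom C v a" "p2 \<cdot> k \<in> Hom C v b" using k b Comp_Hom by auto
  have "l \<cdot> (p1 \<cdot> k) = e \<cdot> (p2 \<cdot> k)"
  proof -
    have "Idn C c \<cdot> (d \<cdot> k) = Zero C v c" using k Comp_Idn_left Zero_Hom by metis
    then have "Idn C c \<cdot> ((l \<cdot> p1) \<cdot> k) = Idn C c \<cdot> ((e \<cdot> p2) \<cdot> k)" using D[OF k(2) Idn_Hom] O by blast
    moreover have "(l \<cdot> p1) \<cdot> k \<in> Hom C v c" "(e \<cdot> p2) \<cdot> k \<in> Hom C v c"
      using Comp_Hom k t1 t2 by blast+
    ultimately have "(l \<cdot> p1) \<cdot> k = (e \<cdot> p2) \<cdot> k" using Comp_Idn_left by metis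
    then show ?thesis using Comp_assoc[OF k(2) b(3) l] Comp_assoc[OF k(2) b(4) e] by simp
  qed
  moreover have "epic C v a (p1 \<cdot> k)"
  proof (rule epicI[OF T(1)])
    \<comment> \<open>As \<open>g \<cdot> p1\<close> kills \<open>k\<close>, it equals
      \<open>h \<cdot> d\<close> for some \<open>h\<close>. Restricted to the summand
      \<open>b\<close> it vanishes, so \<open>h\<close> is zero by \<open>di2\<close>, and
      restricting to the summand \<open>a\<close> shows that \<open>g\<close> is zero.\<close>
    fix z g assume g: "g \<in> Hom C a z" "g \<cdot> (p1 \<cdot> k) = Zero C v z"
    have gp: "g \<cdot> p1 \<in> Hom C s z" using g b Comp_Hom by auto
    have "(g \<cdot> p1) \<cdot> k = Zero C v z" using Comp_assoc[OF k(2) b(3) g(1)] g by simp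
    then obtain h where h: "h \<in> Hom C c z" "h \<cdot> d = g \<cdot> p1" using cokernel_factor[OF dK gp] by blast
    have "h \<cdot> (d \<cdot> i2) = g \<cdot> (p1 \<cdot> i2)" using Comp_assoc[OF b(2) d h(1)] Comp_assoc[OF b(2,3) g(1)] h by simp
    then have "h = Zero C c z" using di2[OF h(1)] b g Comp_Zero O by metis
    then have "g \<cdot> p1 = Zero C s z" using h Zero_Comp d Hom_Ob by metis
    then have "(g \<cdot> p1) \<cdot> i1 = Zero C a z" using Zero_Comp[OF b(1)] g Hom_Ob by metis
    then show "g = Zero C a z" using Comp_assoc[OF b(1,3) g(1)] b(5) Comp_Idn_right[OF g(1)] by simp
  qed
  moreover have "h = Zero C w v"
    if h: "h \<in> Hom C w v" "(p1 \<cdot> k) \<cdot> h = Zero C w a" "(p2 \<cdot> k) \<cdot> h = Zero C w b" for w h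
  proof -
    have kh: "k \<cdot> h \<in> Hom C w s" using k h Comp_Hom by auto
    have w: "w \<in> Ob C" using h Hom_Ob by auto
    have z: "p1 \<cdot> (k \<cdot> h) = Zero C w a" "p2 \<cdot> (k \<cdot> h) = Zero C w b"
      using Comp_assoc[OF h(1) k(2)] b h by auto
    have "k \<cdot> h = Add C (i1 \<cdot> p1) (i2 \<cdot> p2) \<cdot> (k \<cdot> h)" using b Comp_Idn_left kh by simp
    also have "\<dots> = Add C ((i1 \<cdot> p1) \<cdot> (k \<cdot> h)) ((i2 \<cdot> p2) \<cdot> (k \<cdot> h))"
      using Comp_Add_right[OF kh] b Comp_Hom by metis
    also have "\<dots> = Add C (Zero C w s) (Zero C w s)"
      using Comp_assoc[OF kh b(3,1)] Comp_assoc[OF kh b(4,2)] z Comp_Zero[OF b(1) w]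
        Comp_Zero[OF b(2) w] by simp
    also have "\<dots> = Zero C w s" using Add_Zero Zero_Hom w s by blast
    finally show ?thesis using monic_Zero[OF kernel_monic[OF K] h(1)] by blast
  qed
  ultimately show ?thesis using T by blast
qed

end

section \<open>Inverted arrows\<close>

lemma serre_op: "serre_subcategory (op_cat A) \<B> = serre_subcategory A \<B>"
  unfolding serre_subcategory_def by simp blast

lemma inverted_arrow_op [simp]: "inverted_arrow (op_cat A) \<B> x y s = inverted_arrow A \<B> y x s"
  unfolding inverted_arrow_def by auto

locale serre_quotient = abelian_category A for A :: "('o, 'm) precat" (structure) +
  fixes \<B> :: "'o set"
  assumes serre: "serre_subcategory A \<B>"
begin

lemma quotient_op: "serre_quotient (op_cat A) \<B>"
  by (intro serre_quotient.intro serre_quotient_axioms.intro abelian_op) (simp add: serre_op serre)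

lemma serre_iff: "short_exact A x y z f g \<Longrightarrow> y \<in> \<B> \<longleftrightarrow> x \<in> \<B> \<and> z \<in> \<B>"
  using serre unfolding serre_subcategory_def by blast

lemma \<B>_Ob: "b \<in> \<B> \<Longrightarrow> b \<in> Ob A"
  using serre unfolding serre_subcategory_def by blast

lemma \<B>_sub: "monic A x y i \<Longrightarrow> y \<in> \<B> \<Longrightarrow> x \<in> \<B>"
  using ex_cokernel monic_short_exact serre_iff unfolding monic_def by meson

lemma \<B>_quot: "epic A x y p \<Longrightarrow> x \<in> \<B> \<Longrightarrow> y \<in> \<B>"
  using ex_kernel epic_short_exact serre_iff unfolding epic_def by meson

text \<open>\<open>x\<close> is an extension of the coimage of \<open>m\<close>, which embeds in
  \<open>b\<close>, by the kernel \<open>l\<close>.\<close>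

lemma \<B>_ext:
  assumes K: "is_kernel A x b m l i" and "b \<in> \<B>" "l \<in> \<B>"
  shows "x \<in> \<B>"
proof -
  obtain I e where E: "is_cokernel A l x i I e" using ex_cokernel is_kernelD(2)[OF K] by blast
  obtain n where "monic A I b n" using coimage_monic[OF K E] by blast
  then have "I \<in> \<B>" using \<B>_sub assms by blast
  then show ?thesis
    using serre_iff[OF monic_short_exact[OF kernel_monic[OF K] E]] assms by blast
qed

text \<open>The target of an epic zero arrow is a zero object, hence a quotient of any member of the
  nonempty class \<B>.\<close>

lemma zero_in_\<B>:
  assumes "epic A x y p" "p = Zero A x y"
  shows "y \<in> \<B>"
proof -
  obtain b where b: "b \<in> \<B>" using serre unfolding serre_subcategory_def by blast
  have p: "p \<in> Hom A x y" using assms by (simp add: epic_def)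
  have O: "b \<in> Ob A" "x \<in> Ob A" "y \<in> Ob A" using p b \<B>_Ob Hom_Ob by auto
  have "epic A b y (Zero A b y)"
  proof (rule epicI[OF Zero_Hom[OF O(1,3)]])
    fix w g assume g: "g \<in> Hom A y w"
    then have "g \<cdot> p = Zero A x w" using assms(2) Comp_Zero O by simp
    then show "g = Zero A y w" using epic_Zero[OF assms(1) g] by simp
  qed
  then show ?thesis using \<B>_quot b by blast
qed

lemma epic_cokernel_in_\<B>:
  assumes "epic A x y p" "is_cokernel A x y p c q"
  shows "c \<in> \<B>"
  using zero_in_\<B>[OF cokernel_epic[OF assms(2)]] epic_Zero[OF assms(1)] is_cokernelD[OF assms(2)]
  by metis

lemmas monic_kernel_in_\<B> = serre_quotient.epic_cokernel_in_\<B>[OF quotient_op, simplified]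

section \<open>Calculus of fractions for the inverted arrows\<close>

abbreviation inverted where "inverted x y s \<equiv> inverted_arrow A \<B> x y s"

lemma inverted_Hom: "inverted x y s \<Longrightarrow> s \<in> Hom A x y"
  by (simp add: inverted_arrow_def)

lemma inverted_epicI:
  assumes "epic A x y p" "is_kernel A x y p k i" "k \<in> \<B>"
  shows "inverted x y p"
  using assms epic_cokernel_in_\<B>[OF assms(1)] ex_cokernel is_kernelD(1)
  unfolding inverted_arrow_def by metis

lemmas inverted_monicI = serre_quotient.inverted_epicI[OF quotient_op, simplified]

lemma inverted_Idn:
  assumes "x \<in> Ob A"
  shows "inverted x x (Idn A x)"
proof -
  have i: "Idn A x \<in> Hom A x x" by (rule Idn_Hom[OF assms])
  have m: "monic A x x (Idn A x)" "epic A x x (Idn A x)"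
    using i Comp_Idn_left Comp_Idn_right by (auto simp: monic_def epic_def)
  obtain k j where K: "is_kernel A x x (Idn A x) k j" using ex_kernel[OF i] by blast
  show ?thesis using inverted_epicI[OF m(2) K monic_kernel_in_\<B>[OF m(1) K]] .
qed

text \<open>\<open>f\<close> maps the kernel of the composite into \<open>kg\<close>, and the kernel
  \<open>l\<close> of the resulting arrow \<open>m\<close> embeds in \<open>kf\<close>; two members
  of \<B> thus bound \<open>k\<close> from both sides.\<close>

lemma kernel_Comp_in_\<B>:
  assumes f: "is_kernel A x y f kf i" "kf \<in> \<B>" and g: "is_kernel A y z g kg j" "kg \<in> \<B>"
    and K: "is_kernel A x z (g \<cdot> f) k u"
  shows "k \<in> \<B>"
proof -
  note F = is_kernelD[OF f(1)] and G = is_kernelD[OF g(1)] and U = is_kernelD[OF K]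
  have fu: "f \<cdot> u \<in> Hom A k y" using Comp_Hom U F by blast
  have "g \<cdot> (f \<cdot> u) = Zero A k z" using Comp_assoc[OF U(2) F(1) G(1)] U by simp
  then obtain m where m: "m \<in> Hom A k kg" "j \<cdot> m = f \<cdot> u" using kernel_factor[OF g(1) fu] by blast
  obtain l v where L: "is_kernel A k kg m l v" using ex_kernel[OF m(1)] by blast
  note V = is_kernelD[OF L]
  have "f \<cdot> (u \<cdot> v) = Zero A l y"
    using Comp_assoc[OF V(2) U(2) F(1)] Comp_assoc[OF V(2) m(1) G(2)] m V(3) Comp_Zero[OF G(2) V(4)] by simp
  then obtain n where n: "n \<in> Hom A l kf" "i \<cdot> n = u \<cdot> v"
    using kernel_factor[OF f(1) Comp_Hom[OF V(2) U(2)]] by blast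
  have "monic A l kf n"
  proof (rule monicI[OF n(1)])
    fix w h assume h: "h \<in> Hom A w l" "n \<cdot> h = Zero A w kf"
    have w: "w \<in> Ob A" using h Hom_Ob by auto
    have "(u \<cdot> v) \<cdot> h = Zero A w x"
      using Comp_assoc[OF h(1) n(1) F(2)] n h Comp_Zero[OF F(2) w] by simp
    then show "h = Zero A w l"
      using monic_Zero[OF monic_Comp[OF kernel_monic[OF L] kernel_monic[OF K]] h(1)] by simp
  qed
  then have "l \<in> \<B>" using \<B>_sub f(2) by blast
  then show ?thesis using \<B>_ext[OF L g(2)] by blast
qed

lemmas cokernel_Comp_in_\<B> = serre_quotient.kernel_Comp_in_\<B>[OF quotient_op, simplified]

lemma inverted_Comp:
  assumes "inverted x y f" "inverted y z g"
  shows "inverted x z (g \<cdot> f)"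
proof -
  have t: "g \<cdot> f \<in> Hom A x z" using Comp_Hom inverted_Hom assms by blast
  obtain k u where K: "is_kernel A x z (g \<cdot> f) k u" using ex_kernel[OF t] by blast
  obtain c p where P: "is_cokernel A x z (g \<cdot> f) c p" using ex_cokernel[OF t] by blast
  have "k \<in> \<B>" using assms K kernel_Comp_in_\<B> unfolding inverted_arrow_def by metis
  moreover have "c \<in> \<B>" using assms P cokernel_Comp_in_\<B> unfolding inverted_arrow_def by metis
  ultimately show ?thesis using t K P unfolding inverted_arrow_def by blast
qed

text \<open>The cokernel of \<open>i\<close> is the coimage of \<open>e\<close>, which embeds in
  \<open>b\<close>.\<close>

lemma kernel_inverted:
  assumes "is_kernel A x b e k i" "b \<in> \<B>"
  shows "inverted k x i"
proof -
  note i = is_kernelD[OF assms(1)]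
  obtain I p where P: "is_cokernel A k x i I p" using ex_cokernel[OF i(2)] by blast
  obtain n where "monic A I b n" using coimage_monic[OF assms(1) P] by blast
  then have "I \<in> \<B>" using \<B>_sub assms by blast
  then show ?thesis using inverted_monicI[OF kernel_monic[OF assms(1)] P] by blast
qed

text \<open>\<open>t\<close> kills the difference of \<open>f\<close> and \<open>g\<close>, which
  therefore factors through the kernel of \<open>t\<close>, an object of \<B>. The kernel of that
  factor is inverted and equalises \<open>f\<close> and \<open>g\<close>.\<close>

lemma inverted_equalise:
  assumes f: "f \<in> Hom A x y" and g: "g \<in> Hom A x y" and t: "inverted y z t" and e: "t \<cdot> f = t \<cdot> g"
  shows "\<exists>w s. inverted w x s \<and> f \<cdot> s = g \<cdot> s"
proof -
  have tH: "t \<in> Hom A y z" using inverted_Hom[OF t] .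
  have O: "x \<in> Ob A" "y \<in> Ob A" using f Hom_Ob by auto
  obtain d where d: "d \<in> Hom A x y" and D: "\<And>v l z k. l \<in> Hom A v x \<Longrightarrow> k \<in> Hom A y z \<Longrightarrow>
    k \<cdot> (d \<cdot> l) = Zero A v z \<longleftrightarrow> k \<cdot> (f \<cdot> l) = k \<cdot> (g \<cdot> l)"
    using ex_difference[OF f g] by meson
  have "t \<cdot> d = Zero A x z"
    using D[OF Idn_Hom tH] O Comp_Idn_right[OF d] Comp_Idn_right[OF f] Comp_Idn_right[OF g] e by simp
  moreover obtain k i where K: "is_kernel A y z t k i" "k \<in> \<B>" using t by (auto simp: inverted_arrow_def)
  ultimately obtain m where m: "m \<in> Hom A x k" "i \<cdot> m = d" using kernel_factor[OF K(1) d] by blast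
  obtain w s where W: "is_kernel A x k m w s" using ex_kernel[OF m(1)] by blast
  note s = is_kernelD[OF W]
  note i = is_kernelD[OF K(1)]
  have "d \<cdot> s = Zero A w y" using Comp_assoc[OF s(2) m(1) i(2)] m s(3) Comp_Zero[OF i(2) s(4)] by simp
  then have "Idn A y \<cdot> (d \<cdot> s) = Zero A w y" using Comp_Idn_left[OF Comp_Hom[OF s(2) d]] by simp
  then have "f \<cdot> s = g \<cdot> s"
    using D[OF s(2) Idn_Hom] O Comp_Idn_left[OF Comp_Hom[OF s(2) f]] Comp_Idn_left[OF Comp_Hom[OF s(2) g]] by simp
  then show ?thesis using kernel_inverted[OF W K(2)] by blast
qed

lemmas inverted_coequalise = serre_quotient.inverted_equalise[OF quotient_op, simplified]

text \<open>After composing \<open>f\<close> with an inverted monic so that it lands in the image of \<open>t\<close>,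
  one may assume \<open>t\<close> epic, and a pullback of an epic is epic.\<close>

lemma ore:
  assumes f: "f \<in> Hom A w y" and t: "inverted w' y t"
  shows "\<exists>v t' f'. inverted v w t' \<and> f' \<in> Hom A v w' \<and> f \<cdot> t' = t \<cdot> f'"
proof -
  obtain kt i c q where Kt: "is_kernel A w' y t kt i" "kt \<in> \<B>" and Q: "is_cokernel A w' y t c q" "c \<in> \<B>"
    using t unfolding inverted_arrow_def by blast
  note i = is_kernelD[OF Kt(1)] and q = is_cokernelD[OF Q(1)]
  obtain I e where E: "is_cokernel A kt w' i I e" using ex_cokernel[OF i(2)] by blast
  note e = is_cokernelD[OF E]
  obtain n where n: "monic A I y n" "n \<cdot> e = t" using coimage_monic[OF Kt(1) E] by blast
  have nH: "n \<in> Hom A I y" using n by (simp add: monic_def)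
  obtain z g where G: "is_kernel A y z g I n" using monic_normal[OF n(1)] by blast
  note g = is_kernelD[OF G]
  have "g \<cdot> t = Zero A w' z" using Comp_assoc[OF e(2) nH g(1)] n(2) g(3) Zero_Comp[OF e(2) g(6)] by simp
  then obtain g' where g': "g' \<in> Hom A c z" "g' \<cdot> q = g" using cokernel_factor[OF Q(1) g(1)] by blast
  have qf: "q \<cdot> f \<in> Hom A w c" using Comp_Hom f q by blast
  obtain K k where K: "is_kernel A w c (q \<cdot> f) K k" using ex_kernel[OF qf] by blast
  note k = is_kernelD[OF K]
  have fk: "f \<cdot> k \<in> Hom A K y" using Comp_Hom f k by blast
  have "g \<cdot> (f \<cdot> k) = Zero A K z"
    using Comp_assoc[OF fk q(2) g'(1)] g'(2) Comp_assoc[OF k(2) f q(2)] k(3) Comp_Zero[OF g'(1) k(4)] by simp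
  then obtain l where l: "l \<in> Hom A K I" "n \<cdot> l = f \<cdot> k" using kernel_factor[OF G fk] by blast
  obtain v t1 f1 where V: "epic A v K t1" "f1 \<in> Hom A v w'" "l \<cdot> t1 = e \<cdot> f1"
    and joint: "\<And>u h. h \<in> Hom A u v \<Longrightarrow> t1 \<cdot> h = Zero A u K \<Longrightarrow> f1 \<cdot> h = Zero A u w' \<Longrightarrow> h = Zero A u v"
    using pullback_epic[OF l(1) cokernel_epic[OF E]] by blast
  have t1: "t1 \<in> Hom A v K" using V by (simp add: epic_def)
  obtain L j where J: "is_kernel A v K t1 L j" using ex_kernel[OF t1] by blast
  note j = is_kernelD[OF J]
  have f1j: "f1 \<cdot> j \<in> Hom A L w'" using Comp_Hom V(2) j by blast
  have "e \<cdot> (f1 \<cdot> j) = Zero A L I"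
    using Comp_assoc[OF j(2) t1 l(1)] Comp_assoc[OF j(2) V(2) e(2)] V(3) j(3) Comp_Zero[OF l(1) j(4)] by simp
  then have "t \<cdot> (f1 \<cdot> j) = Zero A L y"
    using Comp_assoc[OF f1j e(2) nH] n(2) Comp_Zero[OF nH j(4)] by simp
  then obtain m where m: "m \<in> Hom A L kt" "i \<cdot> m = f1 \<cdot> j" using kernel_factor[OF Kt(1) f1j] by blast
  \<comment> \<open>Joint monicity of the pullback projections embeds the kernel of
    \<open>t1\<close> in the kernel of \<open>t\<close>, so it lies in \<B>.\<close>
  have "monic A L kt m"
  proof (rule monicI[OF m(1)])
    fix u h assume h: "h \<in> Hom A u L" "m \<cdot> h = Zero A u kt"
    have u: "u \<in> Ob A" using h Hom_Ob by auto
    have "f1 \<cdot> (j \<cdot> h) = Zero A u w'"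
      using Comp_assoc[OF h(1) j(2) V(2)] Comp_assoc[OF h(1) m(1) i(2)] m(2) h(2) Comp_Zero[OF i(2) u] by simp
    moreover have "t1 \<cdot> (j \<cdot> h) = Zero A u K"
      using Comp_assoc[OF h(1) j(2) t1] j(3) Zero_Comp[OF h(1) j(6)] by simp
    ultimately have "j \<cdot> h = Zero A u v" using joint[OF Comp_Hom[OF h(1) j(2)]] by blast
    then show "h = Zero A u L" using monic_Zero[OF kernel_monic[OF J] h(1)] by blast
  qed
  then have "L \<in> \<B>" using \<B>_sub Kt(2) by blast
  then have "inverted v w (k \<cdot> t1)"
    using inverted_Comp[OF inverted_epicI[OF V(1) J] kernel_inverted[OF K Q(2)]] by blast
  moreover have "f \<cdot> (k \<cdot> t1) = t \<cdot> f1"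
    using Comp_assoc[OF t1 k(2) f] l(2) Comp_assoc[OF t1 l(1) nH] V(3) Comp_assoc[OF V(2) e(2) nH] n(2) by simp
  ultimately show ?thesis using V(2) by blast
qed

lemmas left_ore = serre_quotient.ore[OF quotient_op, simplified]

end

section \<open>The quotient category\<close>

context serre_quotient
begin

abbreviation rel where "rel x y \<equiv> roof_rel A \<B> x y"
abbreviation frac where "frac x y s f \<equiv> roof_class A \<B> x y (s, f)"
abbreviation Q where "Q \<equiv> quotient_category A \<B>"
abbreviation q where "q x y f \<equiv> quot_arrow A \<B> x y f"

lemma roof_relI:
  assumes "inverted w x s" "f \<in> Hom A w y" "inverted w' x s'" "f' \<in> Hom A w' y"
    "u \<in> Hom A v w" "u' \<in> Hom A v w'" "s \<cdot> u = s' \<cdot> u'" "inverted v x (s \<cdot> u)" "f \<cdot> u = f' \<cdot> u'"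
  shows "((s, f), (s', f')) \<in> rel x y"
  using assms unfolding roof_rel_def by blast

lemma roof_relE:
  assumes "((s, f), (s', f')) \<in> rel x y"
  obtains w w' v u u' where "inverted w x s" "f \<in> Hom A w y" "inverted w' x s'" "f' \<in> Hom A w' y"
    "u \<in> Hom A v w" "u' \<in> Hom A v w'" "s \<cdot> u = s' \<cdot> u'" "inverted v x (s \<cdot> u)" "f \<cdot> u = f' \<cdot> u'"
  using assms unfolding roof_rel_def by blast

lemma roof_rel_refl:
  assumes s: "inverted w x s" and f: "f \<in> Hom A w y"
  shows "((s, f), (s, f)) \<in> rel x y"
proof -
  have w: "w \<in> Ob A" using f Hom_Ob by blast
  show ?thesis
    by (rule roof_relI[OF s f s f Idn_Hom[OF w] Idn_Hom[OF w]])
      (simp_all add: Comp_Idn_right[OF inverted_Hom[OF s]] s)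
qed

lemma roof_rel_sym:
  assumes "(a, b) \<in> rel x y"
  shows "(b, a) \<in> rel x y"
proof -
  obtain s f s' f' where ab: "a = (s, f)" "b = (s', f')" by (cases a, cases b) blast
  obtain w w' v u u' where *: "inverted w x s" "f \<in> Hom A w y" "inverted w' x s'" "f' \<in> Hom A w' y"
    "u \<in> Hom A v w" "u' \<in> Hom A v w'" "s \<cdot> u = s' \<cdot> u'" "inverted v x (s \<cdot> u)" "f \<cdot> u = f' \<cdot> u'"
    using assms unfolding ab by (rule roof_relE)
  then have "inverted v x (s' \<cdot> u')" by simp
  then show ?thesis
    unfolding ab by (rule roof_relI[OF *(3,4,1,2,6,5) *(7)[symmetric] _ *(9)[symmetric]])
qed

text \<open>The two refinements meet over the middle roof. An Ore square makes them agree after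
  composition with \<open>s'\<close> only, so the cancellation lemma is needed to refine once more
  until they agree before \<open>s'\<close>; the numerators can then be compared through
  \<open>f'\<close>.\<close>

lemma roof_rel_trans:
  assumes "(a, b) \<in> rel x y" "(b, c) \<in> rel x y"
  shows "(a, c) \<in> rel x y"
proof -
  obtain s f s' f' s2 f2 where abc: "a = (s, f)" "b = (s', f')" "c = (s2, f2)"
    by (cases a, cases b, cases c) blast
  obtain w w' v u u' where 1: "inverted w x s" "f \<in> Hom A w y" "inverted w' x s'" "f' \<in> Hom A w' y"
    "u \<in> Hom A v w" "u' \<in> Hom A v w'" "s \<cdot> u = s' \<cdot> u'" "inverted v x (s \<cdot> u)" "f \<cdot> u = f' \<cdot> u'"
    using assms(1) unfolding abc by (rule roof_relE)
  obtain w3 w2 v2 r r2 where 2: "inverted w3 x s'" "f' \<in> Hom A w3 y" "inverted w2 x s2" "f2 \<in> Hom A w2 y"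
    "r \<in> Hom A v2 w3" "r2 \<in> Hom A v2 w2" "s' \<cdot> r = s2 \<cdot> r2" "inverted v2 x (s' \<cdot> r)" "f' \<cdot> r = f2 \<cdot> r2"
    using assms(2) unfolding abc by (rule roof_relE)
  \<comment> \<open>Both witnesses mention \<open>f'\<close>, and an arrow determines its
    source.\<close>
  have w3: "w3 = w'" using 1(4) 2(2) Hom_disjoint by blast
  have r: "r \<in> Hom A v2 w'" using 2(5) w3 by simp
  have S: "s \<in> Hom A w x" "s' \<in> Hom A w' x" "s2 \<in> Hom A w2 x" using 1 2 inverted_Hom by auto
  have "inverted v x (s' \<cdot> u')" using 1(7,8) by simp
  then obtain p b a' where b: "inverted p v2 b" "a' \<in> Hom A p v" "s' \<cdot> r \<cdot> b = s' \<cdot> u' \<cdot> a'"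
    using ore[OF Comp_Hom[OF r S(2)]] by blast
  have bH: "b \<in> Hom A p v2" using b inverted_Hom by blast
  have "s' \<cdot> (r \<cdot> b) = s' \<cdot> (u' \<cdot> a')"
    using Comp_assoc[OF bH r S(2)] Comp_assoc[OF b(2) 1(6) S(2)] b(3) by simp
  then obtain p' c' where c: "inverted p' p c'" "r \<cdot> b \<cdot> c' = u' \<cdot> a' \<cdot> c'"
    using inverted_equalise[OF Comp_Hom[OF bH r] Comp_Hom[OF b(2) 1(6)] 1(3)] by blast
  have cH: "c' \<in> Hom A p' p" using c inverted_Hom by blast
  have bc: "b \<cdot> c' \<in> Hom A p' v2" and ac: "a' \<cdot> c' \<in> Hom A p' v" using Comp_Hom bH b(2) cH by blast+
  have E: "r \<cdot> (b \<cdot> c') = u' \<cdot> (a' \<cdot> c')"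
    using Comp_assoc[OF cH bH r] Comp_assoc[OF cH b(2) 1(6)] c(2) by simp
  have X: "s \<cdot> (u \<cdot> (a' \<cdot> c')) = s' \<cdot> (r \<cdot> (b \<cdot> c'))"
    using square_extend[OF 1(7,5) S(1) 1(6) S(2) ac] E by simp
  have Y: "s' \<cdot> (r \<cdot> (b \<cdot> c')) = s2 \<cdot> (r2 \<cdot> (b \<cdot> c'))"
    by (rule square_extend[OF 2(7) r S(2) 2(6) S(3) bc])
  have "inverted p' x ((s' \<cdot> r) \<cdot> (b \<cdot> c'))" by (intro inverted_Comp[OF _ 2(8)] inverted_Comp[OF c(1) b(1)])
  then have I: "inverted p' x (s \<cdot> (u \<cdot> (a' \<cdot> c')))" using Comp_assoc[OF bc r S(2)] X by simp
  have "f \<cdot> (u \<cdot> (a' \<cdot> c')) = f2 \<cdot> (r2 \<cdot> (b \<cdot> c'))"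
    using square_extend[OF 1(9,5,2,6,4) ac] square_extend[OF 2(9) r 1(4) 2(6,4) bc] E by simp
  then show ?thesis
    unfolding abc
    using roof_relI[OF 1(1,2) 2(3,4) Comp_Hom[OF ac 1(5)] Comp_Hom[OF bc 2(6)] _ I] X Y by simp
qed

lemma roof_rel_equiv: "equiv (roofs A \<B> x y) (rel x y)"
proof (rule equivI)
  show "rel x y \<subseteq> roofs A \<B> x y \<times> roofs A \<B> x y"
    unfolding roof_rel_def roofs_def by blast
  show "refl_on (roofs A \<B> x y) (rel x y)"
    unfolding refl_on_def using roof_rel_refl unfolding roofs_def by blast
  show "sym (rel x y)" unfolding sym_def using roof_rel_sym by blast
  show "trans (rel x y)" unfolding trans_def using roof_rel_trans by blast
qed

lemma frac_eqI: "((s, f), (s', f')) \<in> rel x y \<Longrightarrow> frac x y s f = frac x y s' f'"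
  unfolding roof_class_def using roof_rel_equiv by (rule equiv_class_eq)

lemma frac_eqE:
  assumes "frac x y s f = frac x y s' f'"
    "inverted w x s" "f \<in> Hom A w y" "inverted w' x s'" "f' \<in> Hom A w' y"
  obtains v u u' where "u \<in> Hom A v w" "u' \<in> Hom A v w'" "s \<cdot> u = s' \<cdot> u'" "inverted v x (s \<cdot> u)"
    "f \<cdot> u = f' \<cdot> u'"
proof -
  have "(s', f') \<in> roofs A \<B> x y" using assms unfolding roofs_def by blast
  then have "((s, f), (s', f')) \<in> rel x y"
    using assms(1) eq_equiv_class[OF _ roof_rel_equiv] unfolding roof_class_def by blast
  then obtain w1 w2 v u u' where 1: "f \<in> Hom A w1 y" "f' \<in> Hom A w2 y"
    "u \<in> Hom A v w1" "u' \<in> Hom A v w2" "s \<cdot> u = s' \<cdot> u'" "inverted v x (s \<cdot> u)" "f \<cdot> u = f' \<cdot> u'"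
    by (rule roof_relE)
  have "w1 = w" "w2 = w'" using 1(1,2) assms(3,5) Hom_disjoint by blast+
  then show thesis using that 1 by blast
qed

lemma quotient_Ob [simp]: "Ob Q = Ob A"
  by (simp add: quotient_category_def)

lemma quotient_Comp: "Comp Q = quot_comp A \<B>"
  by (simp add: quotient_category_def)

lemma quotient_Hom: "c \<in> Hom Q x y \<longleftrightarrow> (\<exists>w s f. inverted w x s \<and> f \<in> Hom A w y \<and> c = frac x y s f)"
  by (auto simp: quotient_category_def quotient_def roofs_def roof_class_def)

lemma frac_Hom: "inverted w x s \<Longrightarrow> f \<in> Hom A w y \<Longrightarrow> frac x y s f \<in> Hom Q x y"
  unfolding quotient_Hom by blast

lemma quotient_Idn: "Idn Q x = frac x x (Idn A x) (Idn A x)"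
  by (simp add: quotient_category_def quot_arrow_def)

lemma quotient_Zero: "Zero Q x y = q x y (Zero A x y)"
  by (simp add: quotient_category_def)

text \<open>The competing completion \<open>m\<close>, \<open>n\<close> is asked only that
  \<open>s \<cdot> m\<close> be inverted, not \<open>m\<close> itself. This is what
  \<open>roof_rel\<close> provides: a refinement need not be inverted before it is composed with the
  denominator. An Ore square on \<open>m\<close> and \<open>t'\<close> makes \<open>n\<close> and
  \<open>f'\<close> agree after \<open>t\<close>, and a further refinement cancels
  \<open>t\<close>.\<close>

lemma comp_indep:
  assumes s: "inverted w x s" and t: "inverted w' y t" and f: "f \<in> Hom A w y" and g: "g \<in> Hom A w' z"
    and t': "inverted v w t'" and f': "f' \<in> Hom A v w'" and e: "f \<cdot> t' = t \<cdot> f'"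
    and m: "m \<in> Hom A v2 w" and n: "n \<in> Hom A v2 w'" and sm: "inverted v2 x (s \<cdot> m)"
    and e': "f \<cdot> m = t \<cdot> n"
  shows "((s \<cdot> t', g \<cdot> f'), (s \<cdot> m, g \<cdot> n)) \<in> rel x z"
proof -
  note H = inverted_Hom[OF s] inverted_Hom[OF t] inverted_Hom[OF t']
  obtain p a b where a: "inverted p v2 a" "b \<in> Hom A p v" "m \<cdot> a = t' \<cdot> b"
    using ore[OF m t'] by blast
  note aH = inverted_Hom[OF a(1)]
  have "t \<cdot> (n \<cdot> a) = t \<cdot> (f' \<cdot> b)"
    using square_extend[OF e' m f n H(2) aH] square_extend[OF e H(3) f f' H(2) a(2)] a(3) by simp
  then obtain p' c where c: "inverted p' p c" "n \<cdot> a \<cdot> c = f' \<cdot> b \<cdot> c"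
    using inverted_equalise[OF Comp_Hom[OF aH n] Comp_Hom[OF a(2) f'] t] by blast
  note cH = inverted_Hom[OF c(1)]
  have ac: "a \<cdot> c \<in> Hom A p' v2" and bc: "b \<cdot> c \<in> Hom A p' v" using Comp_Hom aH a cH by blast+
  have E: "n \<cdot> (a \<cdot> c) = f' \<cdot> (b \<cdot> c)" "m \<cdot> (a \<cdot> c) = t' \<cdot> (b \<cdot> c)"
    using c(2) Comp_assoc[OF cH aH n] Comp_assoc[OF cH a(2) f'] square_extend[OF a(3) aH m a(2) H(3) cH]
    by simp_all
  have S: "(s \<cdot> t') \<cdot> (b \<cdot> c) = (s \<cdot> m) \<cdot> (a \<cdot> c)"
    using Comp_assoc[OF bc H(3,1)] Comp_assoc[OF ac m H(1)] E(2) by simp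
  have "inverted p' x ((s \<cdot> m) \<cdot> (a \<cdot> c))"
    by (intro inverted_Comp[OF _ sm] inverted_Comp[OF c(1) a(1)])
  moreover have "(g \<cdot> f') \<cdot> (b \<cdot> c) = (g \<cdot> n) \<cdot> (a \<cdot> c)"
    using Comp_assoc[OF bc f' g] Comp_assoc[OF ac n g] E(1) by simp
  ultimately show ?thesis
    using roof_relI[OF inverted_Comp[OF t' s] Comp_Hom[OF f' g] sm Comp_Hom[OF n g] bc ac S] S by simp
qed

lemma comp_indep':
  assumes s: "inverted w x s" and t: "inverted w' y t" and f: "f \<in> Hom A w y" and g: "g \<in> Hom A w' z"
    and m: "m \<in> Hom A v w" "n \<in> Hom A v w'" "inverted v x (s \<cdot> m)" "f \<cdot> m = t \<cdot> n"
    and m': "m' \<in> Hom A v' w" "n' \<in> Hom A v' w'" "inverted v' x (s \<cdot> m')" "f \<cdot> m' = t \<cdot> n'"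
  shows "((s \<cdot> m, g \<cdot> n), (s \<cdot> m', g \<cdot> n')) \<in> rel x z"
proof -
  obtain v1 t' f' where "inverted v1 w t'" "f' \<in> Hom A v1 w'" "f \<cdot> t' = t \<cdot> f'" using ore[OF f t] by blast
  then show ?thesis using comp_indep[OF s t f g] m m' roof_rel_trans roof_rel_sym by meson
qed

text \<open>Both pairs of roofs are refined to common roofs, and one Ore square is completed over
  those. It serves as a completion for the original pair and for the primed pair alike, so
  independence of the completion is applied once on each side.\<close>

lemma comp_welldefined:
  assumes sf: "((s, f), (s', f')) \<in> rel x y" and tg: "((t, g), (t', g')) \<in> rel y z"
    and f: "f \<in> Hom A w y" "g \<in> Hom A k z"
    and m: "m \<in> Hom A v w" "n \<in> Hom A v k" "inverted v x (s \<cdot> m)" "f \<cdot> m = t \<cdot> n"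
    and f': "f' \<in> Hom A w' y" "g' \<in> Hom A k' z"
    and m': "m' \<in> Hom A v' w'" "n' \<in> Hom A v' k'" "inverted v' x (s' \<cdot> m')" "f' \<cdot> m' = t' \<cdot> n'"
  shows "((s \<cdot> m, g \<cdot> n), (s' \<cdot> m', g' \<cdot> n')) \<in> rel x z"
proof -
  obtain w0 w1 p u u' where u0: "inverted w0 x s" "f \<in> Hom A w0 y" "inverted w1 x s'" "f' \<in> Hom A w1 y"
    "u \<in> Hom A p w0" "u' \<in> Hom A p w1"
    and su: "s \<cdot> u = s' \<cdot> u'" "inverted p x (s \<cdot> u)" "f \<cdot> u = f' \<cdot> u'"
    using sf by (rule roof_relE)
  have w: "w0 = w" "w1 = w'" using u0(2,4) f(1) f'(1) Hom_disjoint by blast+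
  have s: "inverted w x s" "inverted w' x s'" and u: "u \<in> Hom A p w" "u' \<in> Hom A p w'" using u0 w by auto
  obtain k0 k1 p' r r' where r0: "inverted k0 y t" "g \<in> Hom A k0 z" "inverted k1 y t'" "g' \<in> Hom A k1 z"
    "r \<in> Hom A p' k0" "r' \<in> Hom A p' k1"
    and tr: "t \<cdot> r = t' \<cdot> r'" "inverted p' y (t \<cdot> r)" "g \<cdot> r = g' \<cdot> r'"
    using tg by (rule roof_relE)
  have k: "k0 = k" "k1 = k'" using r0(2,4) f(2) f'(2) Hom_disjoint by blast+
  have t: "inverted k y t" "inverted k' y t'" and r: "r \<in> Hom A p' k" "r' \<in> Hom A p' k'" using r0 k by auto
  note H = inverted_Hom[OF s(1)] inverted_Hom[OF s(2)] inverted_Hom[OF t(1)] inverted_Hom[OF t(2)]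
  obtain o1 a b where a: "inverted o1 p a" "b \<in> Hom A o1 p'" "f \<cdot> u \<cdot> a = t \<cdot> r \<cdot> b"
    using ore[OF Comp_Hom[OF u(1) f(1)] tr(2)] by blast
  note aH = inverted_Hom[OF a(1)]
  have I: "inverted o1 x (s \<cdot> (u \<cdot> a))"
    using inverted_Comp[OF a(1) su(2)] Comp_assoc[OF aH u(1) H(1)] by simp
  have S: "s \<cdot> (u \<cdot> a) = s' \<cdot> (u' \<cdot> a)" by (rule square_extend[OF su(1) u(1) H(1) u(2) H(2) aH])
  have G: "g \<cdot> (r \<cdot> b) = g' \<cdot> (r' \<cdot> b)" by (rule square_extend[OF tr(3) r(1) f(2) r(2) f'(2) a(2)])
  have F: "f \<cdot> (u \<cdot> a) = t \<cdot> (r \<cdot> b)"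
    using a(3) Comp_assoc[OF aH u(1) f(1)] Comp_assoc[OF a(2) r(1) H(3)] by simp
  have F': "f' \<cdot> (u' \<cdot> a) = t' \<cdot> (r' \<cdot> b)"
    using F square_extend[OF su(3) u(1) f(1) u(2) f'(1) aH] square_extend[OF tr(1) r(1) H(3) r(2) H(4) a(2)]
    by simp
  have "((s \<cdot> m, g \<cdot> n), (s \<cdot> (u \<cdot> a), g \<cdot> (r \<cdot> b))) \<in> rel x z"
    by (rule comp_indep'[OF s(1) t(1) f m Comp_Hom[OF aH u(1)] Comp_Hom[OF a(2) r(1)] I F])
  moreover have "((s' \<cdot> (u' \<cdot> a), g' \<cdot> (r' \<cdot> b)), (s' \<cdot> m', g' \<cdot> n')) \<in> rel x z"
    by (rule comp_indep'[OF s(2) t(2) f' Comp_Hom[OF aH u(2)] Comp_Hom[OF a(2) r(2)] _ F' m'])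
      (use I S in simp)
  ultimately show ?thesis using S G roof_rel_trans by simp
qed

text \<open>Turns the union in \<open>quot_comp\<close> into a computation with one chosen
  completion: the family of classes is nonempty by the Ore condition, and each of its members is the
  stated class.\<close>

lemma frac_Comp:
  assumes s: "inverted w x s" and f: "f \<in> Hom A w y" and t: "inverted w' y t" and g: "g \<in> Hom A w' z"
    and m: "m \<in> Hom A v w" "n \<in> Hom A v w'" "inverted v x (s \<cdot> m)" "f \<cdot> m = t \<cdot> n"
  shows "frac y z t g \<cdot>\<^bsub>Q\<^esub> frac x y s f = frac x z (s \<cdot> m) (g \<cdot> n)"
proof -
  define X where "X = {roof_class A \<B> x' z' (s' \<cdot> t'', g' \<cdot> f'') | x' y' z' w1 w1' v' s' f' t' g' t'' f''.
     (s', f') \<in> frac x y s f \<and> (t', g') \<in> frac y z t g \<and>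
     inverted w1 x' s' \<and> f' \<in> Hom A w1 y' \<and>
     inverted w1' y' t' \<and> g' \<in> Hom A w1' z' \<and>
     inverted v' w1 t'' \<and> f'' \<in> Hom A v' w1' \<and> f' \<cdot> t'' = t' \<cdot> f''}"
  have X: "frac y z t g \<cdot>\<^bsub>Q\<^esub> frac x y s f = \<Union> X"
    unfolding quotient_Comp quot_comp_def X_def by (rule refl)
  obtain v1 t1 f1 where "inverted v1 w t1" "f1 \<in> Hom A v1 w'" "f \<cdot> t1 = t \<cdot> f1" using ore[OF f t] by blast
  then have "frac x z (s \<cdot> t1) (g \<cdot> f1) \<in> X"
    unfolding X_def using s f t g roof_rel_refl unfolding roof_class_def by blast
  moreover have "c = frac x z (s \<cdot> m) (g \<cdot> n)" if cX: "c \<in> X" for c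
  proof -
    obtain x' y' z' w1 w1' v' s' f' t' g' t'' f'' where c: "c = frac x' z' (s' \<cdot> t'') (g' \<cdot> f'')"
      and r: "(s', f') \<in> frac x y s f" "(t', g') \<in> frac y z t g"
      and H: "inverted w1 x' s'" "f' \<in> Hom A w1 y'" "inverted w1' y' t'" "g' \<in> Hom A w1' z'"
      "inverted v' w1 t''" "f'' \<in> Hom A v' w1'" "f' \<cdot> t'' = t' \<cdot> f''"
      using cX unfolding X_def by blast
    have R: "((s, f), (s', f')) \<in> rel x y" "((t, g), (t', g')) \<in> rel y z"
      using r by (simp_all add: roof_class_def)
    \<comment> \<open>The union ranges over all objects, but the arrows of a related roof fix its
      endpoints.\<close>
    have "x' = x" "y' = y" using R(1) H(1,2)
      by (auto elim!: roof_relE dest!: inverted_Hom dest: Hom_disjoint)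
    moreover have "z' = z" using R(2) H(4) by (auto elim!: roof_relE dest: Hom_disjoint)
    ultimately have H': "inverted w1 x s'" "f' \<in> Hom A w1 y" "inverted w1' y t'" "g' \<in> Hom A w1' z"
      and c': "c = frac x z (s' \<cdot> t'') (g' \<cdot> f'')" using H c by auto
    show ?thesis unfolding c'
      by (rule frac_eqI[symmetric, OF comp_welldefined[OF R f g m H'(2,4) inverted_Hom[OF H(5)] H(6)
          inverted_Comp[OF H(5) H'(1)] H(7)]])
  qed
  ultimately show ?thesis unfolding X by blast
qed

lemma quotient_category: "category Q"
proof
  fix c x y assume c: "c \<in> Hom Q x y"
  then obtain w s f where s: "inverted w x s" "f \<in> Hom A w y" "c = frac x y s f"
    unfolding quotient_Hom by blast
  note sH = inverted_Hom[OF s(1)]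
  have O: "w \<in> Ob A" "x \<in> Ob A" "y \<in> Ob A" using sH s(2) Hom_Ob by auto
  show "x \<in> Ob Q \<and> y \<in> Ob Q" using O by simp
  show "Idn Q y \<cdot>\<^bsub>Q\<^esub> c = c"
    unfolding s(3) quotient_Idn
    using frac_Comp[OF s(1,2) inverted_Idn[OF O(3)] Idn_Hom[OF O(3)] Idn_Hom[OF O(1)] s(2)]
      Comp_Idn_left[OF s(2)] Comp_Idn_right[OF s(2)] Comp_Idn_right[OF sH] s(1) by simp
  show "c \<cdot>\<^bsub>Q\<^esub> Idn Q x = c"
    unfolding s(3) quotient_Idn
    using frac_Comp[OF inverted_Idn[OF O(2)] Idn_Hom[OF O(2)] s(1,2) sH Idn_Hom[OF O(1)]]
      Comp_Idn_right[OF s(2)] Comp_Idn_left[OF sH] Comp_Idn_right[OF sH] s(1) by simp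
  show "x = x' \<and> y = y'" if cH: "c \<in> Hom Q x' y'" for x' y'
  proof -
    \<comment> \<open>A class contains its representative, whose two legs determine the source and
      target of the class.\<close>
    have "(s, f) \<in> c" unfolding s(3) roof_class_def using roof_rel_refl[OF s(1,2)] by blast
    moreover obtain w' s' f' where "inverted w' x' s'" "f' \<in> Hom A w' y'" "c = frac x' y' s' f'"
      using cH unfolding quotient_Hom by blast
    ultimately have "((s', f'), (s, f)) \<in> rel x' y'" by (simp add: roof_class_def)
    then obtain w2 where "inverted w2 x' s" "f \<in> Hom A w2 y'" by (auto elim!: roof_relE)
    then show ?thesis using s(2) sH inverted_Hom Hom_disjoint by blast
  qed
next
  fix x assume "x \<in> Ob Q"
  then show "Idn Q x \<in> Hom Q x x" unfolding quotient_Idn using frac_Hom inverted_Idn Idn_Hom by simp blast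
next
  fix a b x y z assume "a \<in> Hom Q x y" "b \<in> Hom Q y z"
  then obtain w s f w' t g where s: "inverted w x s" "f \<in> Hom A w y" "a = frac x y s f"
    and t: "inverted w' y t" "g \<in> Hom A w' z" "b = frac y z t g"
    unfolding quotient_Hom by blast
  obtain v t' f' where v: "inverted v w t'" "f' \<in> Hom A v w'" "f \<cdot> t' = t \<cdot> f'"
    using ore[OF s(2) t(1)] by blast
  note st = inverted_Comp[OF v(1) s(1)]
  show "b \<cdot>\<^bsub>Q\<^esub> a \<in> Hom Q x z"
    unfolding s(3) t(3) frac_Comp[OF s(1,2) t(1,2) inverted_Hom[OF v(1)] v(2) st v(3)]
    by (rule frac_Hom[OF st Comp_Hom[OF v(2) t(2)]])
next
  fix a b c o1 x y z assume "a \<in> Hom Q o1 x" "b \<in> Hom Q x y" "c \<in> Hom Q y z"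
  then obtain w s f w' t g w2 r h where s: "inverted w o1 s" "f \<in> Hom A w x" "a = frac o1 x s f"
    and t: "inverted w' x t" "g \<in> Hom A w' y" "b = frac x y t g"
    and r: "inverted w2 y r" "h \<in> Hom A w2 z" "c = frac y z r h"
    unfolding quotient_Hom by blast
  \<comment> \<open>Three Ore squares form a staircase with apex \<open>v3\<close>; both bracketings
    are read off the same outer roof.\<close>
  obtain v1 r1 g1 where r1: "inverted v1 w' r1" "g1 \<in> Hom A v1 w2" "g \<cdot> r1 = r \<cdot> g1"
    using ore[OF t(2) r(1)] by blast
  obtain v2 t1 f1 where t1: "inverted v2 w t1" "f1 \<in> Hom A v2 w'" "f \<cdot> t1 = t \<cdot> f1"
    using ore[OF s(2) t(1)] by blast
  obtain v3 r2 f2 where r2: "inverted v3 v2 r2" "f2 \<in> Hom A v3 v1" "f1 \<cdot> r2 = r1 \<cdot> f2"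
    using ore[OF t1(2) r1(1)] by blast
  note H = inverted_Hom[OF s(1)] inverted_Hom[OF t(1)] inverted_Hom[OF r(1)] inverted_Hom[OF r1(1)]
    inverted_Hom[OF t1(1)] inverted_Hom[OF r2(1)]
  note tr = inverted_Comp[OF r1(1) t(1)] and st = inverted_Comp[OF t1(1) s(1)]
  note S = inverted_Comp[OF r2(1) st]
  have S': "inverted v3 o1 (s \<cdot> (t1 \<cdot> r2))" using S Comp_assoc[OF H(6,5,1)] by simp
  have cb: "c \<cdot>\<^bsub>Q\<^esub> b = frac x z (t \<cdot> r1) (h \<cdot> g1)"
    unfolding r(3) t(3) by (rule frac_Comp[OF t(1,2) r(1,2) H(4) r1(2) tr r1(3)])
  have ba: "b \<cdot>\<^bsub>Q\<^esub> a = frac o1 y (s \<cdot> t1) (g \<cdot> f1)"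
    unfolding s(3) t(3) by (rule frac_Comp[OF s(1,2) t(1,2) H(5) t1(2) st t1(3)])
  have e1: "f \<cdot> (t1 \<cdot> r2) = t \<cdot> r1 \<cdot> f2"
    using square_extend[OF t1(3) H(5) s(2) t1(2) H(2) H(6)] r2(3) Comp_assoc[OF r2(2) H(4,2)] by simp
  have e2: "g \<cdot> f1 \<cdot> r2 = r \<cdot> (g1 \<cdot> f2)"
    using square_extend[OF r1(3) H(4) t(2) r1(2) H(3) r2(2)] r2(3) Comp_assoc[OF H(6) t1(2) t(2)] by simp
  have 1: "(c \<cdot>\<^bsub>Q\<^esub> b) \<cdot>\<^bsub>Q\<^esub> a = frac o1 z (s \<cdot> (t1 \<cdot> r2)) (h \<cdot> g1 \<cdot> f2)"
    unfolding cb s(3)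
    by (rule frac_Comp[OF s(1,2) tr Comp_Hom[OF r1(2) r(2)] Comp_Hom[OF H(6,5)] r2(2) S' e1])
  have 2: "c \<cdot>\<^bsub>Q\<^esub> (b \<cdot>\<^bsub>Q\<^esub> a) = frac o1 z (s \<cdot> t1 \<cdot> r2) (h \<cdot> (g1 \<cdot> f2))"
    unfolding ba r(3)
    by (rule frac_Comp[OF st Comp_Hom[OF t1(2) t(2)] r(1,2) H(6) Comp_Hom[OF r2(2) r1(2)] S e2])
  show "(c \<cdot>\<^bsub>Q\<^esub> b) \<cdot>\<^bsub>Q\<^esub> a = c \<cdot>\<^bsub>Q\<^esub> (b \<cdot>\<^bsub>Q\<^esub> a)"
    unfolding 1 2 using Comp_assoc[OF H(6,5,1)] Comp_assoc[OF r2(2) r1(2) r(2)] by simp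
qed

end

section \<open>The quotient functor and closed objects\<close>

context serre_quotient
begin

interpretation Q: category Q by (rule quotient_category)

section \<open>Functoriality, zero arrows and exactness of the quotient functor\<close>

lemma q_Hom: "f \<in> Hom A x y \<Longrightarrow> q x y f \<in> Hom Q x y"
  unfolding quot_arrow_def using frac_Hom inverted_Idn Hom_Ob by blast

lemma q_frac:
  assumes s: "inverted w x s" and f: "f \<in> Hom A w y" and g: "g \<in> Hom A y z"
  shows "q y z g \<cdot>\<^bsub>Q\<^esub> frac x y s f = frac x z s (g \<cdot> f)"
proof -
  have O: "w \<in> Ob A" "y \<in> Ob A" using f Hom_Ob by auto
  show ?thesis
    unfolding quot_arrow_def
    using frac_Comp[OF s f inverted_Idn[OF O(2)] g Idn_Hom[OF O(1)] f] s
      Comp_Idn_right[OF inverted_Hom[OF s]] Comp_Idn_right[OF f] Comp_Idn_left[OF f] by simp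
qed

lemma q_Comp:
  assumes "f \<in> Hom A x y" "g \<in> Hom A y z"
  shows "q y z g \<cdot>\<^bsub>Q\<^esub> q x y f = q x z (g \<cdot> f)"
proof -
  have "x \<in> Ob A" using assms Hom_Ob by auto
  then show ?thesis unfolding quot_arrow_def[of A \<B> x] using q_frac inverted_Idn assms by blast
qed

lemma q_Idn: "q x x (Idn A x) = Idn Q x"
  by (simp add: quotient_Idn quot_arrow_def)

lemma frac_q:
  assumes s: "inverted w x s" and f: "f \<in> Hom A w y"
  shows "frac x y s f \<cdot>\<^bsub>Q\<^esub> q w x s = q w y f"
proof -
  have O: "w \<in> Ob A" using f Hom_Ob by auto
  note i = Idn_Hom[OF O]
  show ?thesis
    unfolding quot_arrow_def
    using frac_Comp[OF inverted_Idn[OF O] inverted_Hom[OF s] s f i i]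
      Comp_Idn_right[OF f] Comp_Idn_right[OF i] inverted_Idn[OF O] by simp
qed

lemma q_inverted_iso:
  assumes s: "inverted w x s"
  shows "frac x w s (Idn A w) \<cdot>\<^bsub>Q\<^esub> q w x s = Idn Q w"
    "q w x s \<cdot>\<^bsub>Q\<^esub> frac x w s (Idn A w) = Idn Q x"
proof -
  note sH = inverted_Hom[OF s]
  have O: "w \<in> Ob A" "x \<in> Ob A" using sH Hom_Ob by auto
  note i = Idn_Hom[OF O(1)] and j = Idn_Hom[OF O(2)]
  show "frac x w s (Idn A w) \<cdot>\<^bsub>Q\<^esub> q w x s = Idn Q w"
    using frac_q[OF s i] q_Idn by simp
  have "((s, s), (Idn A x, Idn A x)) \<in> rel x x"
    using roof_relI[OF s sH inverted_Idn[OF O(2)] j i sH] s Comp_Idn_right[OF sH] Comp_Idn_left[OF sH] by simp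
  then show "q w x s \<cdot>\<^bsub>Q\<^esub> frac x w s (Idn A w) = Idn Q x"
    using q_frac[OF s i sH] Comp_Idn_right[OF sH] frac_eqI quotient_Idn by simp
qed

lemma q_iso_arrow: "inverted w x s \<Longrightarrow> iso_arrow Q w x (q w x s)"
  unfolding iso_arrow_def
  using q_inverted_iso q_Hom[OF inverted_Hom] frac_Hom Idn_Hom Hom_Ob[OF inverted_Hom] by meson

lemma q_inverted_cancel:
  assumes t: "inverted y z t" and c: "c \<in> Hom Q x y" "c' \<in> Hom Q x y"
    and e: "q y z t \<cdot>\<^bsub>Q\<^esub> c = q y z t \<cdot>\<^bsub>Q\<^esub> c'"
  shows "c = c'"
proof -
  note tH = q_Hom[OF inverted_Hom[OF t]]
  have "y \<in> Ob A" using inverted_Hom[OF t] Hom_Ob by auto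
  then have i: "frac z y t (Idn A y) \<in> Hom Q z y" using frac_Hom[OF t] Idn_Hom by blast
  show ?thesis
    using Q.Comp_assoc[OF c(1) tH i] Q.Comp_assoc[OF c(2) tH i] e q_inverted_iso(1)[OF t]
      Q.Comp_Idn_left[OF c(1)] Q.Comp_Idn_left[OF c(2)] by simp
qed

lemma q_eqE:
  assumes "q x y f = q x y g" "f \<in> Hom A x y" "g \<in> Hom A x y"
  obtains w s where "inverted w x s" "f \<cdot> s = g \<cdot> s"
proof -
  have O: "x \<in> Ob A" using assms Hom_Ob by auto
  obtain v u u' where u: "u \<in> Hom A v x" "u' \<in> Hom A v x" "Idn A x \<cdot> u = Idn A x \<cdot> u'"
    "inverted v x (Idn A x \<cdot> u)" "f \<cdot> u = g \<cdot> u'"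
    using assms(1) unfolding quot_arrow_def
    by (rule frac_eqE[OF _ inverted_Idn[OF O] assms(2) inverted_Idn[OF O] assms(3)])
  then show thesis using that[of v u] Comp_Idn_left[OF u(1)] Comp_Idn_left[OF u(2)] by simp
qed

lemma frac_zeroI:
  assumes s: "inverted w x s" and y: "y \<in> Ob A"
  shows "frac x y s (Zero A w y) = Zero Q x y"
proof -
  note sH = inverted_Hom[OF s]
  have O: "w \<in> Ob A" "x \<in> Ob A" using sH Hom_Ob by auto
  show ?thesis
    unfolding quotient_Zero quot_arrow_def
    by (rule frac_eqI, rule roof_relI[OF s Zero_Hom[OF O(1) y] inverted_Idn[OF O(2)] Zero_Hom[OF O(2) y]
          Idn_Hom[OF O(1)] sH])
      (use O y s sH in \<open>simp_all add: Comp_Idn_right[OF sH] Comp_Idn_left[OF sH] Zero_Comp[OF sH]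
          Zero_Comp[OF Idn_Hom]\<close>)
qed

lemma quotient_Zero_Hom: "x \<in> Ob A \<Longrightarrow> y \<in> Ob A \<Longrightarrow> Zero Q x y \<in> Hom Q x y"
  unfolding quotient_Zero by (simp add: q_Hom Zero_Hom)

lemma quotient_Comp_Zero:
  assumes c: "c \<in> Hom Q x y" and w: "w \<in> Ob A"
  shows "c \<cdot>\<^bsub>Q\<^esub> Zero Q w x = Zero Q w y"
proof -
  obtain v s f where s: "inverted v x s" "f \<in> Hom A v y" "c = frac x y s f"
    using c unfolding quotient_Hom by blast
  have O: "v \<in> Ob A" "x \<in> Ob A" "y \<in> Ob A" using s(2) c Q.Hom_Ob Hom_Ob by auto
  note i = Idn_Hom[OF w]
  have "Zero A w x \<cdot> Idn A w = s \<cdot> Zero A w v"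
    using Comp_Idn_right[OF Zero_Hom[OF w O(2)]] Comp_Zero[OF inverted_Hom[OF s(1)] w] by simp
  then show ?thesis
    unfolding s(3) quotient_Zero quot_arrow_def
    using frac_Comp[OF inverted_Idn[OF w] Zero_Hom[OF w O(2)] s(1,2) i Zero_Hom[OF w O(1)]]
      Comp_Idn_right[OF i] inverted_Idn[OF w] Comp_Zero[OF s(2) w] by simp
qed

lemma quotient_Zero_Comp:
  assumes c: "c \<in> Hom Q x y" and z: "z \<in> Ob A"
  shows "Zero Q y z \<cdot>\<^bsub>Q\<^esub> c = Zero Q x z"
proof -
  obtain v s f where s: "inverted v x s" "f \<in> Hom A v y" "c = frac x y s f"
    using c unfolding quotient_Hom by blast
  have y: "y \<in> Ob A" using s(2) Hom_Ob by auto
  show ?thesis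
    unfolding s(3) quotient_Zero[of y] using q_frac[OF s(1,2) Zero_Hom[OF y z]] Zero_Comp[OF s(2) z]
      frac_zeroI[OF s(1) z] by simp
qed

text \<open>Completing the roof by the dual Ore condition writes \<open>c\<close> as the inverse of
  \<open>q t\<close> after \<open>q h\<close>, with the inverted arrow now starting at the
  target.\<close>

lemma left_fraction:
  assumes "c \<in> Hom Q x y"
  obtains z t h where "inverted y z t" "h \<in> Hom A x z" "q y z t \<cdot>\<^bsub>Q\<^esub> c = q x z h"
proof -
  obtain w s g where s: "inverted w x s" "g \<in> Hom A w y" "c = frac x y s g"
    using assms unfolding quotient_Hom by blast
  note sH = inverted_Hom[OF s(1)]
  obtain z t h where t: "inverted y z t" "h \<in> Hom A x z" "t \<cdot> g = h \<cdot> s"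
    using left_ore[OF s(2,1)] by metis
  have w: "w \<in> Ob A" "x \<in> Ob A" using sH Hom_Ob by auto
  have "q y z t \<cdot>\<^bsub>Q\<^esub> c = frac x z s (h \<cdot> s)"
    unfolding s(3) using q_frac[OF s(1,2) inverted_Hom[OF t(1)]] t(3) by simp
  also have "\<dots> = q x z h \<cdot>\<^bsub>Q\<^esub> frac x x s s" using q_frac[OF s(1) sH t(2)] by simp
  also have "frac x x s s = Idn Q x"
    using q_inverted_iso(2)[OF s(1)] q_frac[OF s(1) Idn_Hom[OF w(1)] sH] Comp_Idn_right[OF sH] by simp
  also have "q x z h \<cdot>\<^bsub>Q\<^esub> Idn Q x = q x z h" by (rule Q.Comp_Idn_right[OF q_Hom[OF t(2)]])
  finally show thesis using that t by blast
qed

text \<open>A roof killed by \<open>q f\<close> has, after refinement, a numerator killed by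
  \<open>f\<close> in \<open>A\<close>, which factors through \<open>k\<close>. For uniqueness, two
  roofs are brought to a common refinement, where the monic \<open>i\<close> cancels.\<close>

lemma q_kernel:
  assumes K: "is_kernel A x y f k i"
  shows "is_kernel Q x y (q x y f) k (q k x i)"
  unfolding is_kernel_def
proof (intro conjI allI ballI impI)
  note i = is_kernelD[OF K]
  show f: "q x y f \<in> Hom Q x y" and iQ: "q k x i \<in> Hom Q k x" using q_Hom i by auto
  show "q x y f \<cdot>\<^bsub>Q\<^esub> q k x i = Zero Q k y" using q_Comp[OF i(2,1)] i(3) quotient_Zero by simp
  fix w c assume c: "c \<in> Hom Q w x" "q x y f \<cdot>\<^bsub>Q\<^esub> c = Zero Q w y"
  obtain v s g where s: "inverted v w s" "g \<in> Hom A v x" "c = frac w x s g"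
    using c unfolding quotient_Hom by blast
  have w: "w \<in> Ob A" "v \<in> Ob A" using inverted_Hom[OF s(1)] Hom_Ob by auto
  have "frac w y s (f \<cdot> g) = frac w y (Idn A w) (Zero A w y)"
    using c(2) q_frac[OF s(1,2) i(1)] unfolding s(3) quotient_Zero quot_arrow_def by simp
  then obtain v' u u' where u: "u \<in> Hom A v' v" "u' \<in> Hom A v' w" "inverted v' w (s \<cdot> u)"
    "f \<cdot> g \<cdot> u = Zero A w y \<cdot> u'"
    by (rule frac_eqE[OF _ s(1) Comp_Hom[OF s(2) i(1)] inverted_Idn[OF w(1)] Zero_Hom[OF w(1) i(6)]])
  note gu = Comp_Hom[OF u(1) s(2)]
  have "f \<cdot> (g \<cdot> u) = Zero A v' y"
    using u(4) Comp_assoc[OF u(1) s(2) i(1)] Zero_Comp[OF u(2) i(6)] by simp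
  then obtain h where h: "h \<in> Hom A v' k" "i \<cdot> h = g \<cdot> u" using kernel_factor[OF K gu] by blast
  have "((s, g), (s \<cdot> u, g \<cdot> u)) \<in> rel w x"
    using roof_relI[OF s(1,2) u(3) gu u(1) Idn_Hom] u(1,3) Hom_Ob[OF u(1)]
      Comp_Idn_right[OF inverted_Hom[OF u(3)]] Comp_Idn_right[OF gu] by simp
  then have "q k x i \<cdot>\<^bsub>Q\<^esub> frac w k (s \<cdot> u) h = c"
    unfolding s(3) using q_frac[OF u(3) h(1) i(2)] h(2) frac_eqI by simp
  moreover have "a = b" if ab: "a \<in> Hom Q w k" "b \<in> Hom Q w k" "q k x i \<cdot>\<^bsub>Q\<^esub> a = q k x i \<cdot>\<^bsub>Q\<^esub> b" for a b
  proof -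
    obtain w1 s1 g1 where s1: "inverted w1 w s1" "g1 \<in> Hom A w1 k" "a = frac w k s1 g1"
      using ab unfolding quotient_Hom by blast
    obtain w2 s2 g2 where s2: "inverted w2 w s2" "g2 \<in> Hom A w2 k" "b = frac w k s2 g2"
      using ab unfolding quotient_Hom by blast
    have "frac w x s1 (i \<cdot> g1) = frac w x s2 (i \<cdot> g2)"
      using ab(3) q_frac[OF s1(1,2) i(2)] q_frac[OF s2(1,2) i(2)] unfolding s1(3) s2(3) by simp
    then obtain p r r' where r: "r \<in> Hom A p w1" "r' \<in> Hom A p w2" "s1 \<cdot> r = s2 \<cdot> r'"
      "inverted p w (s1 \<cdot> r)" "i \<cdot> g1 \<cdot> r = i \<cdot> g2 \<cdot> r'"
      by (rule frac_eqE[OF _ s1(1) Comp_Hom[OF s1(2) i(2)] s2(1) Comp_Hom[OF s2(2) i(2)]])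
    have "i \<cdot> (g1 \<cdot> r) = i \<cdot> (g2 \<cdot> r')"
      using r(5) Comp_assoc[OF r(1) s1(2) i(2)] Comp_assoc[OF r(2) s2(2) i(2)] by simp
    then have "g1 \<cdot> r = g2 \<cdot> r'"
      by (rule monic_cancel[OF kernel_monic[OF K] Comp_Hom[OF r(1) s1(2)] Comp_Hom[OF r(2) s2(2)]])
    then show ?thesis
      unfolding s1(3) s2(3) by (intro frac_eqI roof_relI[OF s1(1,2) s2(1,2) r(1-4)])
  qed
  ultimately show "\<exists>!h. h \<in> Hom Q w k \<and> q k x i \<cdot>\<^bsub>Q\<^esub> h = c" using frac_Hom[OF u(3) h(1)] by blast
qed

text \<open>The quotient of \<open>op_cat A\<close> consists of classes of cospans in
  \<open>A\<close> instead of roofs, so this is not the literal dual of the statement on kernels.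
  The argument is dual in spirit and runs on left fractions.\<close>

lemma q_cokernel:
  assumes P: "is_cokernel A x y f c p"
  shows "is_cokernel Q x y (q x y f) c (q y c p)"
  unfolding is_cokernel_def
proof (intro conjI allI ballI impI)
  note p = is_cokernelD[OF P]
  show fQ: "q x y f \<in> Hom Q x y" and pQ: "q y c p \<in> Hom Q y c" using q_Hom p by auto
  show "q y c p \<cdot>\<^bsub>Q\<^esub> q x y f = Zero Q x c" using q_Comp[OF p(1,2)] p(3) quotient_Zero by simp
  fix z a assume a: "a \<in> Hom Q y z" "a \<cdot>\<^bsub>Q\<^esub> q x y f = Zero Q x z"
  obtain z1 t h where t: "inverted z z1 t" "h \<in> Hom A y z1" "q z z1 t \<cdot>\<^bsub>Q\<^esub> a = q y z1 h"
    using left_fraction[OF a(1)] by blast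
  note tH = inverted_Hom[OF t(1)]
  have O: "z \<in> Ob A" "z1 \<in> Ob A" using tH Hom_Ob by auto
  have hf: "h \<cdot> f \<in> Hom A x z1" using Comp_Hom t p by blast
  have "q x z1 (h \<cdot> f) = q x z1 (Zero A x z1)"
    using q_Comp[OF p(1) t(2)] t(3) Q.Comp_assoc[OF fQ a(1) q_Hom[OF tH]] a(2)
      quotient_Comp_Zero[OF q_Hom[OF tH] p(6)] quotient_Zero by simp
  then obtain v u where u: "inverted v x u" "h \<cdot> f \<cdot> u = Zero A x z1 \<cdot> u"
    by (rule q_eqE[OF _ hf Zero_Hom[OF p(6) O(2)]])
  \<comment> \<open>Equality in the quotient holds in \<open>A\<close> after precomposition with
    \<open>u\<close>. Trading this for a postcomposition with \<open>d\<close> lets the cokernel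
    property of \<open>p\<close> act on \<open>d \<cdot> h\<close>.\<close>
  obtain z2 d where d: "inverted z1 z2 d" "d \<cdot> (h \<cdot> f) = d \<cdot> Zero A x z1"
    using inverted_coequalise[OF hf Zero_Hom[OF p(6) O(2)] u] by blast
  note dH = inverted_Hom[OF d(1)]
  have dh: "d \<cdot> h \<in> Hom A y z2" using Comp_Hom t dH by blast
  have "d \<cdot> h \<cdot> f = Zero A x z2" using Comp_assoc[OF p(1) t(2) dH] d(2) Comp_Zero[OF dH p(6)] by simp
  then obtain l where l: "l \<in> Hom A c z2" "l \<cdot> p = d \<cdot> h" using cokernel_factor[OF P dh] by blast
  have dt: "inverted z z2 (d \<cdot> t)" using inverted_Comp t d by blast
  \<comment> \<open>The left fraction with numerator \<open>l\<close> and denominator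
    \<open>d \<cdot> t\<close>.\<close>
  define b where "b = frac z2 z (d \<cdot> t) (Idn A z) \<cdot>\<^bsub>Q\<^esub> q c z2 l"
  have i: "frac z2 z (d \<cdot> t) (Idn A z) \<in> Hom Q z2 z" using frac_Hom[OF dt Idn_Hom[OF O(1)]] .
  note lQ = q_Hom[OF l(1)]
  have b: "b \<in> Hom Q c z" unfolding b_def by (rule Q.Comp_Hom[OF lQ i])
  have "q z z2 (d \<cdot> t) \<cdot>\<^bsub>Q\<^esub> b = q c z2 l"
    unfolding b_def
    using Q.Comp_assoc[OF lQ i q_Hom[OF inverted_Hom[OF dt]]] q_inverted_iso(2)[OF dt] Q.Comp_Idn_left[OF lQ]
    by simp
  then have "q z z2 (d \<cdot> t) \<cdot>\<^bsub>Q\<^esub> (b \<cdot>\<^bsub>Q\<^esub> q y c p) = q y z2 (d \<cdot> h)"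
    using Q.Comp_assoc[OF pQ b q_Hom[OF inverted_Hom[OF dt]]] q_Comp[OF p(2) l(1)] l(2) by simp
  also have "\<dots> = q z z2 (d \<cdot> t) \<cdot>\<^bsub>Q\<^esub> a"
    using q_Comp[OF t(2) dH] t(3) Q.Comp_assoc[OF a(1) q_Hom[OF tH] q_Hom[OF dH]] q_Comp[OF tH dH] by simp
  finally have "b \<cdot>\<^bsub>Q\<^esub> q y c p = a" by (rule q_inverted_cancel[OF dt Q.Comp_Hom[OF pQ b] a(1)])
  moreover have "b = b'" if bb: "b \<in> Hom Q c z" "b' \<in> Hom Q c z" "b \<cdot>\<^bsub>Q\<^esub> q y c p = b' \<cdot>\<^bsub>Q\<^esub> q y c p" for b b'
  proof -
    obtain v1 t1 g1 where t1: "inverted z v1 t1" "g1 \<in> Hom A c v1" "q z v1 t1 \<cdot>\<^bsub>Q\<^esub> b = q c v1 g1"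
      using left_fraction[OF bb(1)] by blast
    obtain v2 t2 g2 where t2: "inverted z v2 t2" "g2 \<in> Hom A c v2" "q z v2 t2 \<cdot>\<^bsub>Q\<^esub> b' = q c v2 g2"
      using left_fraction[OF bb(2)] by blast
    note tH = inverted_Hom[OF t1(1)] inverted_Hom[OF t2(1)]
    \<comment> \<open>Common denominator of the two left fractions; the epic \<open>p\<close> can
      then be cancelled from the numerators.\<close>
    obtain v r r' where r: "inverted v1 v r" "r' \<in> Hom A v2 v" "r \<cdot> t1 = r' \<cdot> t2"
      using left_ore[OF tH(1) t2(1)] by metis
    note rH = inverted_Hom[OF r(1)]
    have G: "r \<cdot> g1 \<in> Hom A c v" "r' \<cdot> g2 \<in> Hom A c v" using Comp_Hom rH r(2) t1(2) t2(2) by blast+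
    have T: "inverted z v (r \<cdot> t1)" by (rule inverted_Comp[OF t1(1) r(1)])
    note TH = q_Hom[OF inverted_Hom[OF T]]
    have 1: "q z v (r \<cdot> t1) \<cdot>\<^bsub>Q\<^esub> b = q c v (r \<cdot> g1)"
      using Q.Comp_assoc[OF bb(1) q_Hom[OF tH(1)] q_Hom[OF rH]] q_Comp[OF tH(1) rH] t1(3) q_Comp[OF t1(2) rH]
      by simp
    have 2: "q z v (r \<cdot> t1) \<cdot>\<^bsub>Q\<^esub> b' = q c v (r' \<cdot> g2)"
      using Q.Comp_assoc[OF bb(2) q_Hom[OF tH(2)] q_Hom[OF r(2)]] q_Comp[OF tH(2) r(2)] t2(3)
        q_Comp[OF t2(2) r(2)] r(3) by simp
    have "q y v (r \<cdot> g1 \<cdot> p) = q y v (r' \<cdot> g2 \<cdot> p)"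
      using q_Comp[OF p(2) G(1)] q_Comp[OF p(2) G(2)] 1 2 Q.Comp_assoc[OF pQ bb(1) TH]
        Q.Comp_assoc[OF pQ bb(2) TH] bb(3) by simp
    then obtain v' u where u: "inverted v' y u" "r \<cdot> g1 \<cdot> p \<cdot> u = r' \<cdot> g2 \<cdot> p \<cdot> u"
      by (rule q_eqE[OF _ Comp_Hom[OF p(2) G(1)] Comp_Hom[OF p(2) G(2)]])
    obtain z2 d where d: "inverted v z2 d" "d \<cdot> (r \<cdot> g1 \<cdot> p) = d \<cdot> (r' \<cdot> g2 \<cdot> p)"
      using inverted_coequalise[OF Comp_Hom[OF p(2) G(1)] Comp_Hom[OF p(2) G(2)] u] by blast
    note dH = inverted_Hom[OF d(1)]
    have "d \<cdot> (r \<cdot> g1) \<cdot> p = d \<cdot> (r' \<cdot> g2) \<cdot> p"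
      using d(2) Comp_assoc[OF p(2) G(1) dH] Comp_assoc[OF p(2) G(2) dH] by simp
    then have "d \<cdot> (r \<cdot> g1) = d \<cdot> (r' \<cdot> g2)"
      by (rule epic_cancel[OF cokernel_epic[OF P] Comp_Hom[OF G(1) dH] Comp_Hom[OF G(2) dH]])
    then have "q v z2 d \<cdot>\<^bsub>Q\<^esub> q c v (r \<cdot> g1) = q v z2 d \<cdot>\<^bsub>Q\<^esub> q c v (r' \<cdot> g2)"
      using q_Comp[OF G(1) dH] q_Comp[OF G(2) dH] by simp
    then have "q c v (r \<cdot> g1) = q c v (r' \<cdot> g2)"
      by (rule q_inverted_cancel[OF d(1) q_Hom[OF G(1)] q_Hom[OF G(2)]])
    then show ?thesis using q_inverted_cancel[OF T bb(1,2)] 1 2 by simp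
  qed
  ultimately show "\<exists>!h. h \<in> Hom Q c z \<and> h \<cdot>\<^bsub>Q\<^esub> q y c p = a" using b by blast
qed

section \<open>Arrows into closed objects and the two implications\<close>

abbreviation \<E> where "\<E> \<equiv> closed_objects A \<B>"

lemma closed_Ob: "e \<in> \<E> \<Longrightarrow> e \<in> Ob A"
  by (simp add: closed_objects_def)

lemma closed_Hom: "e \<in> \<E> \<Longrightarrow> b \<in> \<B> \<Longrightarrow> f \<in> Hom A b e \<Longrightarrow> f = Zero A b e"
  by (auto simp: closed_objects_def)

text \<open>The class of the extension contains the extension itself and is an element of
  \<open>Ext1\<close>, hence equals the zero class; the biproduct structure supplies the
  retraction.\<close>

lemma closed_split:
  assumes e: "e \<in> \<E>" and b: "b \<in> \<B>" and S: "short_exact A e y b i p"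
  shows "\<exists>r\<in>Hom A y e. r \<cdot> i = Idn A e"
proof -
  have i: "i \<in> Hom A e y" and p: "p \<in> Hom A y b" using S by (auto simp: short_exact_def is_kernel_def)
  have y: "y \<in> Ob A" using i Hom_Ob by blast
  have x: "(y, i, p) \<in> extensions A b e" using S by (simp add: extensions_def)
  have "iso_arrow A y y (Idn A y)"
    unfolding iso_arrow_def using Idn_Hom[OF y] Comp_Idn_left[OF Idn_Hom[OF y]] by blast
  then have "((y, i, p), (y, i, p)) \<in> ext_rel A b e"
    unfolding ext_rel_def using x Comp_Idn_left[OF i] Comp_Idn_right[OF p] by blast
  then have "(y, i, p) \<in> ext_rel A b e `` {(y, i, p)}" by blast
  moreover have "ext_rel A b e `` {(y, i, p)} \<in> Ext1 A b e" unfolding Ext1_def quotient_def using x by blast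
  ultimately have "(y, i, p) \<in> Ext1_zero A b e" using e b by (auto simp: closed_objects_def)
  then show ?thesis unfolding Ext1_zero_def is_biproduct_def by blast
qed

text \<open>An arrow that vanishes in the quotient vanishes after an inverted \<open>s\<close>, so
  it factors through the cokernel of \<open>s\<close>. That cokernel is in \<B> and has only the
  zero arrow to \<open>e\<close>.\<close>

lemma closed_faithful:
  assumes e: "e \<in> \<E>" and f: "f \<in> Hom A x e" and z: "q x e f = Zero Q x e"
  shows "f = Zero A x e"
proof -
  have O: "x \<in> Ob A" "e \<in> Ob A" using f Hom_Ob by auto
  obtain w s where s: "inverted w x s" "f \<cdot> s = Zero A x e \<cdot> s"
    using z unfolding quotient_Zero by (rule q_eqE[OF _ f Zero_Hom[OF O]])
  obtain c p where P: "c \<in> \<B>" "is_cokernel A w x s c p" using s(1) unfolding inverted_arrow_def by blast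
  note p = is_cokernelD[OF P(2)]
  obtain g where g: "g \<in> Hom A c e" "g \<cdot> p = f"
    using cokernel_factor[OF P(2) f] s(2) Zero_Comp[OF p(1) O(2)] by auto
  then show ?thesis using closed_Hom[OF e P(1) g(1)] Zero_Comp[OF p(2) O(2)] by simp
qed

lemma closed_full:
  assumes e: "e \<in> \<E>" and c: "c \<in> Hom Q x e"
  shows "\<exists>f\<in>Hom A x e. c = q x e f"
proof -
  obtain z t h where t: "inverted e z t" "h \<in> Hom A x z" "q e z t \<cdot>\<^bsub>Q\<^esub> c = q x z h"
    using left_fraction[OF c] by blast
  note tH = inverted_Hom[OF t(1)]
  obtain k i b p where K: "k \<in> \<B>" "is_kernel A e z t k i" and P: "b \<in> \<B>" "is_cokernel A e z t b p"
    using t(1) unfolding inverted_arrow_def by blast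
  note i = is_kernelD[OF K(2)]
  have "monic A e z t"
  proof (rule monicI[OF tH])
    fix w g assume g: "g \<in> Hom A w e" "t \<cdot> g = Zero A w z"
    then obtain l where l: "l \<in> Hom A w k" "i \<cdot> l = g" using kernel_factor[OF K(2)] by blast
    then show "g = Zero A w e" using closed_Hom[OF e K(1) i(2)] Zero_Comp[OF l(1) i(5)] by simp
  qed
  \<comment> \<open>The monic \<open>t\<close> and its cokernel \<open>b\<close> form an extension
    of \<open>b\<close> by \<open>e\<close>, which splits. Applying \<open>q r\<close> to the left
    fraction removes the denominator and exhibits \<open>c\<close> as the image of
    \<open>r \<cdot> h\<close>.\<close>
  then obtain r where r: "r \<in> Hom A z e" "r \<cdot> t = Idn A e"
    using closed_split[OF e P(1) monic_short_exact[OF _ P(2)]] by blast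
  have "q x e (r \<cdot> h) = q e e (r \<cdot> t) \<cdot>\<^bsub>Q\<^esub> c"
    using q_Comp[OF t(2) r(1)] t(3) Q.Comp_assoc[OF c q_Hom[OF tH] q_Hom[OF r(1)]] q_Comp[OF tH r(1)] by simp
  also have "\<dots> = c" using r(2) q_Idn Q.Comp_Idn_left[OF c] by simp
  finally show ?thesis using Comp_Hom[OF t(2) r(1)] by blast
qed

text \<open>Moved along the isomorphism to a closed object, an arrow lifts to \<open>A\<close> by
  fullness, and there it vanishes.\<close>

lemma Hom_essential_image_zero:
  assumes t: "t \<in> left_perp A \<E>" and x: "x \<in> quot_essential_image A \<B> \<E>"
  shows "Hom Q t x = {Zero Q t x}"
proof -
  have O: "t \<in> Ob A" "x \<in> Ob A" using t x by (auto simp: left_perp_def quot_essential_image_def)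
  obtain e a where e: "e \<in> \<E>" "iso_arrow Q e x a"
    using x unfolding quot_essential_image_def isomorphic_def quot_obj_def by blast
  then obtain b where ab: "a \<in> Hom Q e x" "b \<in> Hom Q x e" "a \<cdot>\<^bsub>Q\<^esub> b = Idn Q x"
    unfolding iso_arrow_def by blast
  have "c = Zero Q t x" if c: "c \<in> Hom Q t x" for c
  proof -
    obtain f where f: "f \<in> Hom A t e" "b \<cdot>\<^bsub>Q\<^esub> c = q t e f"
      using closed_full[OF e(1) Q.Comp_Hom[OF c ab(2)]] by blast
    have "f = Zero A t e" using t e(1) f(1) by (auto simp: left_perp_def)
    then have "a \<cdot>\<^bsub>Q\<^esub> (b \<cdot>\<^bsub>Q\<^esub> c) = Zero Q t x"
      using f(2) quotient_Zero quotient_Comp_Zero[OF ab(1) O(1)] by simp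
    then show ?thesis using Q.Comp_assoc[OF c ab(2,1)] ab(3) Q.Comp_Idn_left[OF c] by simp
  qed
  then show ?thesis using quotient_Zero_Hom[OF O] by blast
qed

lemma embedding_imp_weakly_localising:
  assumes T: "torsion_pair A (left_perp A \<E>) \<F>" and E: "embedding_condition A \<B> \<E> \<F>"
  shows "weakly_localising A \<B>"
  unfolding weakly_localising_def torsion_pair_def
proof (intro exI conjI ballI)
  \<comment> \<open>This goal fixes the torsion class: the torsion part of the pair in
    \<open>A\<close>, which can be taken over unchanged because both categories have the same
    objects.\<close>
  show "left_perp A \<E> \<subseteq> Ob Q" by (auto simp: left_perp_def)
  show "quot_essential_image A \<B> \<E> \<subseteq> Ob Q" by (auto simp: quot_essential_image_def)
  show "Hom Q t x = {Zero Q t x}" if "t \<in> left_perp A \<E>" "x \<in> quot_essential_image A \<B> \<E>" for t x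
    using Hom_essential_image_zero that .
  fix a assume "a \<in> Ob Q"
  then obtain t f i p where t: "t \<in> left_perp A \<E>" "f \<in> \<F>" "short_exact A t a f i p"
    using T unfolding torsion_pair_def by auto
  obtain g b j r where g: "g \<in> \<E>" "b \<in> \<B>" "short_exact A f g b j r"
    using E t(2) unfolding embedding_condition_def by blast
  have K: "is_kernel A g b r f j" and P: "is_cokernel A f g j b r"
    using g(3) by (auto simp: short_exact_def)
  have "inverted f g j" by (rule inverted_monicI[OF kernel_monic[OF K] P g(2)])
  then obtain h where "iso_arrow Q g f h" using q_iso_arrow unfolding iso_arrow_def by blast
  moreover have "f \<in> Ob A" using is_kernelD[OF K] by blast
  ultimately have "f \<in> quot_essential_image A \<B> \<E>"
    using g(1) unfolding quot_essential_image_def isomorphic_def quot_obj_def by auto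
  moreover have "short_exact Q t a f (q t a i) (q a f p)"
    using t(3) q_kernel q_cokernel unfolding short_exact_def by blast
  ultimately show "\<exists>t\<in>left_perp A \<E>. \<exists>f\<in>quot_essential_image A \<B> \<E>. \<exists>i p. short_exact Q t a f i p"
    using t(1) by blast
qed

lemma weakly_localising_imp_embedding:
  assumes T: "torsion_pair A (left_perp A \<E>) \<F>" and W: "weakly_localising A \<B>"
  shows "embedding_condition A \<B> \<E> \<F>"
  unfolding embedding_condition_def
proof
  fix f assume f: "f \<in> \<F>"
  have fO: "f \<in> Ob A" using T f unfolding torsion_pair_def by blast
  obtain \<T> where \<T>: "torsion_pair Q \<T> (quot_essential_image A \<B> \<E>)"
    using W unfolding weakly_localising_def by blast
  obtain t x i p where t: "t \<in> \<T>" "x \<in> quot_essential_image A \<B> \<E>" "short_exact Q t f x i p"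
    using \<T> fO unfolding torsion_pair_def by auto
  have tO: "t \<in> Ob A" using \<T> t(1) unfolding torsion_pair_def by auto
  have iH: "i \<in> Hom Q t f" and pH: "p \<in> Hom Q f x" and pi: "p \<cdot>\<^bsub>Q\<^esub> i = Zero Q t x"
    using t(3) by (auto simp: short_exact_def is_kernel_def)
  obtain e a b where e: "e \<in> \<E>" "a \<in> Hom Q e x" "b \<in> Hom Q x e" "b \<cdot>\<^bsub>Q\<^esub> a = Idn Q e" "a \<cdot>\<^bsub>Q\<^esub> b = Idn Q x"
    using t(2) unfolding quot_essential_image_def isomorphic_def quot_obj_def iso_arrow_def by blast
  have eO: "e \<in> Ob A" "x \<in> Ob A" using closed_Ob e(1) Q.Hom_Ob[OF e(2)] by auto
  obtain m where m: "m \<in> Hom A f e" "b \<cdot>\<^bsub>Q\<^esub> p = q f e m"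
    using closed_full[OF e(1) Q.Comp_Hom[OF pH e(3)]] by blast
  note mQ = q_Hom[OF m(1)]
  have am: "a \<cdot>\<^bsub>Q\<^esub> q f e m = p"
    using Q.Comp_assoc[OF pH e(3,2)] m(2) e(5) Q.Comp_Idn_left[OF pH] by simp
  \<comment> \<open>In the quotient, \<open>m\<close> is \<open>p\<close> up to the isomorphism
    between \<open>e\<close> and \<open>x\<close>, so \<open>K\<close> and \<open>t\<close> are
    kernels of the same arrow up to isomorphism. The comparison arrows \<open>j\<close> and
    \<open>l\<close> follow from the two kernel properties.\<close>
  obtain K k where K: "is_kernel A f e m K k" using ex_kernel[OF m(1)] by blast
  note k = is_kernelD[OF K] and kQ = q_kernel[OF K]
  note kH = q_Hom[OF k(2)]
  have "q f e m \<cdot>\<^bsub>Q\<^esub> i = Zero Q t e"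
    using Q.Comp_assoc[OF iH pH e(3)] m(2) pi quotient_Comp_Zero[OF e(3) tO] by simp
  then obtain j where j: "j \<in> Hom Q t K" "q K f k \<cdot>\<^bsub>Q\<^esub> j = i"
    using kQ iH unfolding is_kernel_def by blast
  have "p \<cdot>\<^bsub>Q\<^esub> q K f k = Zero Q K x"
    using am Q.Comp_assoc[OF kH mQ e(2)] kQ quotient_Comp_Zero[OF e(2) k(4)] unfolding is_kernel_def by simp
  then obtain l where l: "l \<in> Hom Q K t" "i \<cdot>\<^bsub>Q\<^esub> l = q K f k"
    using t(3) kH unfolding short_exact_def is_kernel_def by blast
  have jl: "j \<cdot>\<^bsub>Q\<^esub> l = Idn Q K"
  proof -
    have "q f e m \<cdot>\<^bsub>Q\<^esub> q K f k = Zero Q K e" using kQ by (simp add: is_kernel_def)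
    then have "\<exists>!h. h \<in> Hom Q K K \<and> q K f k \<cdot>\<^bsub>Q\<^esub> h = q K f k"
      using kQ kH unfolding is_kernel_def by blast
    moreover have "q K f k \<cdot>\<^bsub>Q\<^esub> (j \<cdot>\<^bsub>Q\<^esub> l) = q K f k"
      using Q.Comp_assoc[OF l(1) j(1) kH] j(2) l(2) by simp
    moreover have "q K f k \<cdot>\<^bsub>Q\<^esub> Idn Q K = q K f k" by (rule Q.Comp_Idn_right[OF kH])
    moreover have "Idn Q K \<in> Hom Q K K" using Q.Idn_Hom k(4) by simp
    ultimately show ?thesis using Q.Comp_Hom[OF l(1) j(1)] by blast
  qed
  \<comment> \<open>As \<open>j\<close> followed by nothing but \<open>l\<close> before it is the
    identity of \<open>K\<close>, the image of an arrow from \<open>K\<close> factors through the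
    torsion object \<open>t\<close> and is zero; faithfulness brings this back to
    \<open>A\<close>.\<close>
  have "Hom A K e' = {Zero A K e'}" if e': "e' \<in> \<E>" for e'
  proof -
    have "e' \<in> quot_essential_image A \<B> \<E>"
      using e' closed_Ob[OF e'] q_iso_arrow[OF inverted_Idn]
      unfolding quot_essential_image_def isomorphic_def quot_obj_def by auto
    then have Z: "Hom Q t e' = {Zero Q t e'}" using \<T> t(1) unfolding torsion_pair_def by blast
    have "g = Zero A K e'" if g: "g \<in> Hom A K e'" for g
    proof -
      note gQ = q_Hom[OF g]
      have "q K e' g \<cdot>\<^bsub>Q\<^esub> j = Zero Q t e'" using Z Q.Comp_Hom[OF j(1) gQ] by blast
      then have "q K e' g = Zero Q K e'"
        using Q.Comp_assoc[OF l(1) j(1) gQ] jl Q.Comp_Idn_right[OF gQ]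
          quotient_Zero_Comp[OF l(1) closed_Ob[OF e']] by simp
      then show ?thesis by (rule closed_faithful[OF e' g])
    qed
    then show ?thesis using Zero_Hom[OF k(4) closed_Ob[OF e']] by blast
  qed
  then have "K \<in> left_perp A \<E>" using k(4) by (simp add: left_perp_def)
  \<comment> \<open>\<open>k\<close> runs from the torsion class to the torsion-free class of the
    pair in \<open>A\<close>.\<close>
  then have k0: "k = Zero A K f" using T f k(2) unfolding torsion_pair_def by blast
  have mono: "monic A f e m"
  proof (rule monicI[OF m(1)])
    fix w g assume g: "g \<in> Hom A w f" "m \<cdot> g = Zero A w e"
    then obtain h where "h \<in> Hom A w K" "k \<cdot> h = g" using kernel_factor[OF K] by blast
    then show "g = Zero A w f" using k0 Zero_Comp fO by metis
  qed
  obtain c d where C: "is_cokernel A f e m c d" using ex_cokernel[OF m(1)] by blast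
  note d = is_cokernelD[OF C] and dQ = q_Hom[OF is_cokernelD(2)[OF C]]
  \<comment> \<open>Both this arrow and the zero arrow give zero after \<open>p\<close>; uniqueness
    in the cokernel property of \<open>p\<close> identifies them, and cancelling the isomorphism
    \<open>b\<close> shows that \<open>d\<close> vanishes in the quotient.\<close>
  have db: "q e c d \<cdot>\<^bsub>Q\<^esub> b \<in> Hom Q x c" by (rule Q.Comp_Hom[OF e(3) dQ])
  have z1: "q e c d \<cdot>\<^bsub>Q\<^esub> b \<cdot>\<^bsub>Q\<^esub> p = Zero Q f c"
    using Q.Comp_assoc[OF pH e(3) dQ] m(2) q_Comp[OF m(1) d(2)] d(3) quotient_Zero by simp
  have z2: "Zero Q x c \<cdot>\<^bsub>Q\<^esub> p = Zero Q f c" by (rule quotient_Zero_Comp[OF pH d(4)])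
  have "Zero Q f c \<cdot>\<^bsub>Q\<^esub> i = Zero Q t c" by (rule quotient_Zero_Comp[OF iH d(4)])
  then have "\<exists>!h. h \<in> Hom Q x c \<and> h \<cdot>\<^bsub>Q\<^esub> p = Zero Q f c"
    using t(3) quotient_Zero_Hom[OF fO d(4)] unfolding short_exact_def is_cokernel_def by blast
  then have "q e c d \<cdot>\<^bsub>Q\<^esub> b = Zero Q x c" using z1 z2 db quotient_Zero_Hom[OF eO(2) d(4)] by blast
  then have "q e c d = Zero Q e c"
    using Q.Comp_assoc[OF e(2,3) dQ] e(4) Q.Comp_Idn_right[OF dQ] quotient_Zero_Comp[OF e(2) d(4)] by simp
  then obtain w u where u: "inverted w e u" "d \<cdot> u = Zero A e c \<cdot> u"
    unfolding quotient_Zero by (rule q_eqE[OF _ d(2) Zero_Hom[OF eO(1) d(4)]])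
  \<comment> \<open>Since \<open>d\<close> kills the inverted \<open>u\<close>, it factors through
    the cokernel \<open>v\<close> of \<open>u\<close>. The epic \<open>d\<close> makes the factor
    \<open>s\<close> epic, so \<open>c\<close> is a quotient of an object of \<B>.\<close>
  obtain v r where R: "v \<in> \<B>" "is_cokernel A w e u v r" using u(1) unfolding inverted_arrow_def by blast
  have "d \<cdot> u = Zero A w c" using u(2) Zero_Comp[OF inverted_Hom[OF u(1)] d(4)] by simp
  then obtain s where s: "s \<in> Hom A v c" "s \<cdot> r = d" using cokernel_factor[OF R(2) d(2)] by blast
  have "epic A v c s"
  proof (rule epicI[OF s(1)])
    fix y g assume g: "g \<in> Hom A c y" "g \<cdot> s = Zero A v y"
    have y: "y \<in> Ob A" using g Hom_Ob by auto
    have "g \<cdot> d = Zero A e y"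
      using Comp_assoc[OF is_cokernelD(2)[OF R(2)] s(1) g(1)] s(2) g(2)
        Zero_Comp[OF is_cokernelD(2)[OF R(2)] y] by simp
    then show "g = Zero A c y" by (rule epic_Zero[OF cokernel_epic[OF C] g(1)])
  qed
  then have "c \<in> \<B>" using \<B>_quot R(1) by blast
  then show "\<exists>g\<in>\<E>. \<exists>b\<in>\<B>. \<exists>i p. short_exact A f g b i p"
    using e(1) monic_short_exact[OF mono C] by blast
qed

end

theorem theorem3p11:
  fixes A :: "('o, 'm) precat" and \<B> \<F> :: "'o set"
  assumes "abelian_category A"
    and "serre_subcategory A \<B>"
    and "torsion_pair A (left_perp A (closed_objects A \<B>)) \<F>"
  shows "weakly_localising A \<B> \<longleftrightarrow> embedding_condition A \<B> (closed_objects A \<B>) \<F>"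
proof -
  interpret serre_quotient A \<B>
    using assms(1,2) by (simp add: serre_quotient_def serre_quotient_axioms_def)
  show ?thesis
    using embedding_imp_weakly_localising weakly_localising_imp_embedding assms(3) by blast
qed

end
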